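(* Let $K\ge1$ and $k=\frac{K-1}{K+1}$. Suppose that $f(z)=h(z)+\overline{g(z)}=\sum_{n=0}^{\infty}a_nz^n+\overline{\sum_{n=1}^{\infty}b_nz^n}$ is a $K$-quasiconformal sense-preserving harmonic mapping in $\mathbb{D}$ and $h\prec\psi$, where $\psi$ is univalent in $\mathbb{D}$. Then $$|h(z)|+\sum_{n=1}^{\infty}(|a_n|+|b_n|)r^n\le|\psi(0)|+\operatorname{dist}(\psi(0),\partial\psi(\mathbb{D}))\quad\text{for } |z|=r\le r_u(k),$$ where $r_u(k)$ is the unique root of the equation $8r+4kr\sqrt{1+r}-(1-r)^2=0$ in $(0,1)$.
   Context: $\mathbb{D}=\{z\in\mathbb{C}:|z|<1\}$. A harmonic mapping $f=h+\overline{g}$ in $\mathbb{D}$ ($h,g$ analytic, $g(0)=0$) is sense-preserving if $J_f=|h'|^2-|g'|^2>0$ in $\mathbb{D}$, equivalently $h'\neq0$ and the dilatation $\omega_f=g'/h'$ satisfies $|\omega_f|<1$ in $\mathbb{D}$. A sense-preserving homeomorphism $f$ of $\mathbb{D}$ onto a domain, in the Sobolev class $W^{1,2}_{loc}(\mathbb{D})$, is $K$-quasiconformal if $\frac{|f_z|+|f_{\bar z}|}{|f_z|-|f_{\bar z}|}\le K$ in $\mathbb{D}$; for $f=h+\overline g$ this means $|\omega_f(z)|\le k=\frac{K-1}{K+1}$, i.e. $|g'(z)|\le k|h'(z)|$ in $\mathbb{D}$. The relation $h\prec\psi$ is the usual subordination: $h=\psi\circ\omega$ for some analytic $\omega:\mathbb{D}\to\mathbb{D}$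 with $\omega(0)=0$. "Univalent" means analytic and injective on $\mathbb{D}$. $\operatorname{dist}$ is Euclidean distance. *)

theory Defs
  imports "HOL-Complex_Analysis.Complex_Analysis"
begin

abbreviation unit_disc :: "complex set" (\<open>\<bbbD>\<close>)
  where "\<bbbD> \<equiv> ball 0 1"

definition univalent :: "(complex \<Rightarrow> complex) \<Rightarrow> bool" where
  "univalent \<psi> \<longleftrightarrow> \<psi> holomorphic_on \<bbbD> \<and> inj_on \<psi> \<bbbD>"

definition subordinate :: "(complex \<Rightarrow> complex) \<Rightarrow> (complex \<Rightarrow> complex) \<Rightarrow> bool" (infix \<open>\<prec>\<^sub>s\<close> 50) where
  "h \<prec>\<^sub>s \<psi> \<longleftrightarrow> (\<exists>\<omega>. \<omega> holomorphic_on \<bbbD> \<and> \<omega> ` \<bbbD> \<subseteq> \<bbbD> \<and> \<omega> 0 = 0 \<and> (\<forall>z\<in>\<bbbD>. h z = \<psi> (\<omega> z)))"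

definition harmonic_mapping ::
  "(complex \<Rightarrow> complex) \<Rightarrow> (complex \<Rightarrow> complex) \<Rightarrow> (complex \<Rightarrow> complex) \<Rightarrow> bool" where
  "harmonic_mapping f h g \<longleftrightarrow>
     h holomorphic_on \<bbbD> \<and> g holomorphic_on \<bbbD> \<and> g 0 = 0 \<and> (\<forall>z\<in>\<bbbD>. f z = h z + cnj (g z))"

definition sense_preserving_harmonic_mapping ::
  "(complex \<Rightarrow> complex) \<Rightarrow> (complex \<Rightarrow> complex) \<Rightarrow> (complex \<Rightarrow> complex) \<Rightarrow> bool" where
  "sense_preserving_harmonic_mapping f h g \<longleftrightarrow>
     harmonic_mapping f h g \<and> (\<forall>z\<in>\<bbbD>. (cmod (deriv h z))\<^sup>2 - (cmod (deriv g z))\<^sup>2 > 0)"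

text \<open>Wirtinger derivatives \<open>f\<^sub>z = (f\<^sub>x - i f\<^sub>y) / 2\<close> and \<open>f\<^sub>z\<^sub>b = (f\<^sub>x + i f\<^sub>y) / 2\<close>
  (\<open>zb\<close> being the conjugate variable); they are meaningful at points of real differentiability only.\<close>

definition wirtinger_z :: "(complex \<Rightarrow> complex) \<Rightarrow> complex \<Rightarrow> complex" where
  "wirtinger_z f z =
     (frechet_derivative f (at z) 1 - \<i> * frechet_derivative f (at z) \<i>) / 2"

definition wirtinger_zbar :: "(complex \<Rightarrow> complex) \<Rightarrow> complex \<Rightarrow> complex" where
  "wirtinger_zbar f z =
     (frechet_derivative f (at z) 1 + \<i> * frechet_derivative f (at z) \<i>) / 2"

text \<open>Test functions are taken to be compactly supported of class \<open>C\<^sup>1\<close>; by mollification this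
  gives the same weak derivatives as smooth test functions.\<close>

definition test_function_on :: "complex set \<Rightarrow> (complex \<Rightarrow> real) \<Rightarrow> bool" where
  "test_function_on S \<phi> \<longleftrightarrow>
     (\<forall>z. \<phi> differentiable (at z)) \<and>
     (\<forall>v. continuous_on UNIV (\<lambda>z. frechet_derivative \<phi> (at z) v)) \<and>
     compact (closure {z. \<phi> z \<noteq> 0}) \<and> closure {z. \<phi> z \<noteq> 0} \<subseteq> S"

definition L2_loc_on :: "complex set \<Rightarrow> (complex \<Rightarrow> complex) \<Rightarrow> bool" where
  "L2_loc_on S u \<longleftrightarrow>
     set_borel_measurable lebesgue S u \<and>
     (\<forall>C. compact C \<and> C \<subseteq> S \<longrightarrow> set_integrable lebesgue C (\<lambda>z. (cmod (u z))\<^sup>2))"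

definition weak_directional_derivative_on ::
  "complex set \<Rightarrow> complex \<Rightarrow> (complex \<Rightarrow> complex) \<Rightarrow> (complex \<Rightarrow> complex) \<Rightarrow> bool" where
  "weak_directional_derivative_on S v f u \<longleftrightarrow>
     (\<forall>\<phi>. test_function_on S \<phi> \<longrightarrow>
        set_lebesgue_integral lebesgue S (\<lambda>z. frechet_derivative \<phi> (at z) v *\<^sub>R f z) =
        - set_lebesgue_integral lebesgue S (\<lambda>z. \<phi> z *\<^sub>R u z))"

definition W12_loc_on :: "complex set \<Rightarrow> (complex \<Rightarrow> complex) \<Rightarrow> bool" where
  "W12_loc_on S f \<longleftrightarrow>
     L2_loc_on S f \<and>
     (\<exists>fx fy. L2_loc_on S fx \<and> L2_loc_on S fy \<and>
        weak_directional_derivative_on S 1 f fx \<and> weak_directional_derivative_on S \<i> f fy)"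

text \<open>A quasiconformal map is in general differentiable only almost everywhere, and the dilatation
  bound is meant at almost every point; there \<open>|f\<^sub>z\<^sub>b| < |f\<^sub>z|\<close> (positive Jacobian) expresses that the
  Sobolev homeomorphism \<open>f\<close> preserves orientation. For harmonic \<open>f\<close> the inequality
  \<open>|f\<^sub>z| + |f\<^sub>z\<^sub>b| \<le> K (|f\<^sub>z| - |f\<^sub>z\<^sub>b|)\<close> then holds at every point, by continuity of the derivatives.\<close>

definition quasiconformal :: "real \<Rightarrow> (complex \<Rightarrow> complex) \<Rightarrow> bool" where
  "quasiconformal K f \<longleftrightarrow>
     (\<exists>\<Omega> f'. open \<Omega> \<and> connected \<Omega> \<and> homeomorphism \<bbbD> \<Omega> f f') \<and>
     W12_loc_on \<bbbD> f \<and>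
     (AE z in lebesgue. z \<in> \<bbbD> \<longrightarrow>
        f differentiable (at z) \<and>
        cmod (wirtinger_zbar f z) < cmod (wirtinger_z f z) \<and>
        (cmod (wirtinger_z f z) + cmod (wirtinger_zbar f z)) /
        (cmod (wirtinger_z f z) - cmod (wirtinger_zbar f z)) \<le> K)"

definition bohr_root :: "real \<Rightarrow> real \<Rightarrow> bool" where
  "bohr_root k r \<longleftrightarrow> 0 < r \<and> r < 1 \<and> 8 * r + 4 * k * r * sqrt (1 + r) - (1 - r)\<^sup>2 = 0"

definition r\<^sub>u :: "real \<Rightarrow> real" where
  "r\<^sub>u k = (THE r. bohr_root k r)"

end

theory Submission
  imports Defs
begin

text \<open>The expected route bounds the coefficients of \<open>h\<close> by those of the Koebe function, which for a
  function subordinate to a univalent one is de Branges' theorem. It is avoided because only small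
  radii \<open>r \<le> 1/9\<close> matter. Bohr's inequality, applied to \<open>(\<omega>/z)\<^sup>k\<close> and to the dilatation \<open>g'/h'\<close>,
  reduces everything to the majorant \<open>M(r) = \<Sum> |A\<^sub>n| r\<^sup>n\<close> of a normalised univalent
  function \<open>z + A\<^sub>2 z\<^sup>2 + \<dots>\<close>: the left-hand side is at most \<open>|\<psi>(0)| + (2 + k) |\<psi>'(0)| M(r)\<close>.
  Koebe's theorem in the form \<open>dist \<ge> |\<psi>'(0)| / (2 + |A\<^sub>2|)\<close> leaves a gain linear in
  \<open>e = 2 - |A\<^sub>2|\<close>, so that \<open>M(r) \<le> r (1 - r)\<^sup>-\<^sup>2 (1 + e/4)\<close> suffices.

  After a rotation \<open>A\<^sub>2 \<ge> 0\<close>. Then \<open>|A\<^sub>n| \<le> Re A\<^sub>n + |A\<^sub>n - n|\<^sup>2 / (2n)\<close>, where the real parts sum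
  to \<open>Re f(r)\<close>, which the growth theorem controls, and the area theorem makes the squared deviations
  from the Koebe function \<open>O(e)\<close>. When \<open>e > 1\<close>, crude coefficient bounds are enough.\<close>

text \<open>The tight case is the Koebe function, \<open>e = 0\<close>, where the allowance
  \<open>1 + e/4\<close> leaves no slack, so the estimate may degrade at most linearly in
  \<open>e\<close>. Since it is the squared deviations that are of order \<open>e\<close>, the plain
  bound \<open>|A_n| <= n + |A_n - n|\<close> would lose a term of order \<open>sqrt e\<close>.
  Comparing \<open>|A_n|\<close> with \<open>Re A_n\<close> makes the loss quadratic in the
  deviation, hence linear in \<open>e\<close>. The link from \<open>A_2\<close> to all other
  coefficients is \<open>q = sqrt (z / f)\<close>. It equals \<open>1 - z\<close> for the Koebe
  function, its first coefficient is \<open>- A_2 / 2\<close>, and the area theorem leaves for the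
  remaining ones only \<open>1 - A_2^2 / 4 <= e\<close>. The radii fit together:
  \<open>1/9 = (1/3)^2\<close>, so \<open>r^n\<close> is dominated by the weights
  \<open>(1/3)^(2 n)\<close> of Parseval's identity on \<open>|z| = 1/3\<close>, and 1/3 is also the
  radius of Bohr's inequality.\<close>

no_notation fps_nth (infixl \<open>$\<close> 75)

section \<open>Power series on the unit disc\<close>

lemma fps_expansion_sums:
  assumes "f holomorphic_on ball 0 1" "f has_fps_expansion F" "cmod z < 1"
  shows "(\<lambda>n. fps_nth F n * z ^ n) sums f z"
  using holomorphic_power_series[OF assms(1), of z] assms(3)
  by (simp add: fps_nth_fps_expansion[OF assms(2)])

lemma sums_imp_has_fps_expansion:
  fixes f :: "complex \<Rightarrow> complex"
  assumes "\<And>z. cmod z < 1 \<Longrightarrow> (\<lambda>n. a n * z ^ n) sums f z"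
  shows "f has_fps_expansion Abs_fps a"
  by (rule has_fps_expansionI, rule eventually_mono[OF eventually_nhds_in_open[of "ball 0 1"]])
     (use assms in auto)

lemma fps_expansion_abs_summable:
  assumes "f holomorphic_on ball 0 1" "f has_fps_expansion F" "0 \<le> r" "r < 1"
  shows "summable (\<lambda>n. cmod (fps_nth F n) * r ^ n)"
proof -
  have "summable (\<lambda>n. fps_nth F n * of_real ((1 + r) / 2) ^ n)"
    using fps_expansion_sums[OF assms(1,2), of "of_real ((1 + r) / 2)"] assms(3,4)
    by (auto simp: sums_iff simp del: of_real_divide of_real_add)
  from powser_insidea[OF this, of "of_real r"] show ?thesis
    using assms(3,4) by (simp add: norm_mult norm_power del: of_real_divide of_real_add)
qed

section \<open>Orthogonality and Parseval's identity on circles\<close>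

lemma has_integral_cis_power:
  fixes m :: int
  shows "((\<lambda>t. cis (of_int m * t)) has_integral (if m = 0 then of_real (2 * pi) else 0)) {-pi..pi}"
proof (cases "m = 0")
  case True
  have "((\<lambda>t. 1) has_integral (pi - - pi) *\<^sub>R (1::complex)) {-pi..pi}"
    by (rule has_integral_const_real[THEN has_integral_eq_rhs]) (auto simp: scaleR_conv_of_real)
  then show ?thesis
    using True by (simp add: scaleR_conv_of_real)
next
  case False
  have "((\<lambda>t. cis (of_int m * t)) has_integral
      (cis (of_int m * pi) / (\<i> * of_int m) - cis (of_int m * - pi) / (\<i> * of_int m))) {-pi..pi}"
  proof (rule fundamental_theorem_of_calculus)
    fix x :: real assume "x \<in> {-pi..pi}"
    show "((\<lambda>t. cis (of_int m * t) / (\<i> * of_int m)) has_vector_derivative cis (of_int m * x))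
        (at x within {-pi..pi})"
      unfolding cis_conv_exp using False
      by (auto intro!: derivative_eq_intros has_vector_derivative_real_field
          simp: field_simps)
  qed auto
  moreover have "cis (of_int m * pi) = cis (of_int m * - pi)"
    using sin_npi_int[of m] by (simp add: complex_eq_iff mult.commute)
  ultimately show ?thesis
    using False by simp
qed

text \<open>Expanding the square gives a double sum of exponentials of frequency
  \<open>j - k\<close>, of which only the diagonal survives integration.\<close>

lemma integral_norm_trig_polynomial:
  fixes c :: "nat \<Rightarrow> complex"
  shows "((\<lambda>t. (cmod (\<Sum>n<N. c n * cis (of_nat n * t)))\<^sup>2)
          has_integral (2 * pi * (\<Sum>n<N. (cmod (c n))\<^sup>2))) {-pi..pi}"
proof -
  have "((\<lambda>t. \<Sum>j<N. \<Sum>k<N. c j * cnj (c k) * cis (of_int (int j - int k) * t)) has_integral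
     (\<Sum>j<N. \<Sum>k<N. c j * cnj (c k) * (if int j - int k = 0 then of_real (2 * pi) else 0))) {-pi..pi}"
    by (intro has_integral_sum has_integral_mult_right has_integral_cis_power) auto
  also have "(\<Sum>j<N. \<Sum>k<N. c j * cnj (c k) * (if int j - int k = 0 then of_real (2 * pi) else 0))
      = (\<Sum>j<N. \<Sum>k<N. if k = j then c j * cnj (c k) * of_real (2 * pi) else 0)"
    by (intro sum.cong) auto
  also have "\<dots> = of_real (2 * pi * (\<Sum>n<N. (cmod (c n))\<^sup>2))"
    by (simp add: sum.delta' complex_norm_square[symmetric] sum_distrib_left mult_ac)
  also have "(\<lambda>t. \<Sum>j<N. \<Sum>k<N. c j * cnj (c k) * cis (of_int (int j - int k) * t))
     = (\<lambda>t. of_real ((cmod (\<Sum>n<N. c n * cis (of_nat n * t)))\<^sup>2))"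
  proof
    fix t
    have "of_real ((cmod (\<Sum>n<N. c n * cis (of_nat n * t)))\<^sup>2)
       = (\<Sum>n<N. c n * cis (of_nat n * t)) * cnj (\<Sum>n<N. c n * cis (of_nat n * t))"
      by (metis complex_norm_square)
    also have "\<dots> = (\<Sum>j<N. \<Sum>k<N. c j * cis (of_nat j * t) * (cnj (c k) * cis (- (of_nat k * t))))"
      by (simp add: sum_product cis_cnj)
    also have "\<dots> = (\<Sum>j<N. \<Sum>k<N. c j * cnj (c k) * cis (of_int (int j - int k) * t))"
      by (intro sum.cong) (auto simp: cis_mult algebra_simps simp flip: cis_divide)
    finally show "(\<Sum>j<N. \<Sum>k<N. c j * cnj (c k) * cis (of_int (int j - int k) * t))
       = of_real ((cmod (\<Sum>n<N. c n * cis (of_nat n * t)))\<^sup>2)" by simp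
  qed
  finally have *: "((\<lambda>t. complex_of_real ((cmod (\<Sum>n<N. c n * cis (of_nat n * t)))\<^sup>2)) has_integral
      complex_of_real (2 * pi * (\<Sum>n<N. (cmod (c n))\<^sup>2))) {-pi..pi}" .
  show ?thesis
    using has_integral_Re[OF *] by simp
qed

text \<open>Absolute convergence inside the disc makes the partial sums converge uniformly on the
  circle, so the identity for trigonometric polynomials survives the limit.\<close>

lemma parseval_circle:
  assumes hol: "f holomorphic_on ball 0 1" and F: "f has_fps_expansion F" and r: "0 \<le> r" "r < 1"
  shows "(\<lambda>n. (cmod (fps_nth F n))\<^sup>2 * r ^ (2 * n)) sums
           (integral {-pi..pi} (\<lambda>t. (cmod (f (of_real r * cis t)))\<^sup>2) / (2 * pi))"
    and "(\<lambda>t. (cmod (f (of_real r * cis t)))\<^sup>2) integrable_on {-pi..pi}"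
proof -
  define S where "S N t = (\<Sum>n<N. fps_nth F n * of_real r ^ n * cis (of_nat n * t))" for N t
  have cont: "continuous_on {-pi..pi} (\<lambda>t. f (of_real r * cis t))"
    by (rule continuous_on_compose2[OF holomorphic_on_imp_continuous_on[OF hol]])
       (use r in \<open>auto intro!: continuous_intros simp: norm_mult\<close>)
  have "uniform_limit {-pi..pi} (\<lambda>N t. \<Sum>n<N. fps_nth F n * of_real r ^ n * cis (of_nat n * t))
      (\<lambda>t. \<Sum>n. fps_nth F n * of_real r ^ n * cis (of_nat n * t)) sequentially"
    by (rule Weierstrass_m_test[OF _ fps_expansion_abs_summable[OF hol F r]])
       (use r in \<open>auto simp: norm_mult norm_power\<close>)
  moreover have eq: "(\<Sum>n. fps_nth F n * of_real r ^ n * cis (of_nat n * t)) = f (of_real r * cis t)" for t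
    using fps_expansion_sums[OF hol F, of "of_real r * cis t"] r
    by (simp add: sums_iff norm_mult power_mult_distrib Complex.DeMoivre mult.assoc)
  ultimately have lim: "uniform_limit {-pi..pi} S (\<lambda>t. f (of_real r * cis t)) sequentially"
    unfolding S_def[abs_def] eq by simp
  have bd: "bounded ((\<lambda>t. cmod (f (of_real r * cis t))) ` {-pi..pi})"
    by (intro compact_imp_bounded compact_continuous_image continuous_intros cont) auto
  have lim2: "uniform_limit {-pi..pi} (\<lambda>N t. (cmod (S N t))\<^sup>2) (\<lambda>t. (cmod (f (of_real r * cis t)))\<^sup>2) sequentially"
    unfolding power2_eq_square
    by (intro uniform_lim_mult uniform_limit_norm lim bd)
  have "continuous_on {-pi..pi} (\<lambda>t. (cmod (S N t))\<^sup>2)" for N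
    unfolding S_def by (intro continuous_intros)
  from uniform_limit_integral[OF lim2 this] obtain I J where
    I: "\<And>N. ((\<lambda>t. (cmod (S N t))\<^sup>2) has_integral I N) {-pi..pi}"
    and J: "((\<lambda>t. (cmod (f (of_real r * cis t)))\<^sup>2) has_integral J) {-pi..pi}"
    and IJ: "I \<longlonglongrightarrow> J" by auto
  have "I N = 2 * pi * (\<Sum>n<N. (cmod (fps_nth F n))\<^sup>2 * r ^ (2 * n))" for N
    using has_integral_unique[OF I[of N], unfolded S_def, OF integral_norm_trig_polynomial]
    using r by (simp add: norm_mult norm_power power_mult_distrib power_mult[symmetric] mult_ac)
  then have "(\<lambda>N. 2 * pi * (\<Sum>n<N. (cmod (fps_nth F n))\<^sup>2 * r ^ (2 * n)) / (2 * pi)) \<longlonglongrightarrow> J / (2 * pi)"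
    using tendsto_divide[OF IJ tendsto_const, of "2 * pi"] by (simp add: fun_eq_iff)
  then show "(\<lambda>n. (cmod (fps_nth F n))\<^sup>2 * r ^ (2 * n)) sums
           (integral {-pi..pi} (\<lambda>t. (cmod (f (of_real r * cis t)))\<^sup>2) / (2 * pi))"
    using integral_unique[OF J] by (simp add: sums_def)
  show "(\<lambda>t. (cmod (f (of_real r * cis t)))\<^sup>2) integrable_on {-pi..pi}"
    using J by blast
qed

text \<open>The change of variables for areas is stated on \<open>real^2\<close>, the iterated
  integral of a continuous function on pairs. The coordinate map \<open>g\<close> preserves boxes
  and their contents, so one integral carries over to the other.\<close>

lemma integral_cart2_continuous:
  fixes F :: "real \<times> real \<Rightarrow> real"
  assumes "continuous_on (cbox (a, c) (b, d)) F"
  shows "((\<lambda>x::real^2. F (x $ 1, x $ 2)) has_integral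
           integral {a..b} (\<lambda>x. integral {c..d} (\<lambda>y. F (x, y)))) (cbox (vector [a, c]) (vector [b, d]))"
proof -
  define g where "g = (\<lambda>x::real^2. (x $ 1, x $ 2))"
  define h where "h = (\<lambda>(x::real, y::real). vector [x, y] :: real^2)"
  have hg: "h (g x) = x" for x by (simp add: h_def g_def vec_eq_iff forall_2)
  have gh: "g (h x) = x" for x by (simp add: h_def g_def split: prod.split)
  have mem: "x \<in> cbox u v \<longleftrightarrow> g x \<in> cbox (g u) (g v)" for x u v
    by (auto simp: g_def mem_box_cart forall_2 cbox_Pair_eq)
  have gim: "g ` cbox u v = cbox (g u) (g v)" for u v
  proof
    show "g ` cbox u v \<subseteq> cbox (g u) (g v)" using mem by blast
    show "cbox (g u) (g v) \<subseteq> g ` cbox u v"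
    proof
      fix y assume y: "y \<in> cbox (g u) (g v)"
      then have "h y \<in> cbox u v" using mem[of "h y" u v] gh by metis
      then show "y \<in> g ` cbox u v" using gh[of y] by (metis imageI)
    qed
  qed
  have him: "h ` cbox u v = cbox (h u) (h v)" for u v
  proof -
    have "h ` cbox u v = h ` (g ` cbox (h u) (h v))" by (simp only: gim gh)
    then show ?thesis by (simp add: image_image hg)
  qed
  have int: "(F has_integral integral (cbox (a, c) (b, d)) F) (cbox (a, c) (b, d))"
    by (simp add: integrable_continuous assms integrable_integral)
  have cont: "measure lborel (g ` cbox u v) = 1 * measure lborel (cbox u v)" for u v
  proof (cases "cbox u v = {}")
    case False
    then have "cbox (g u) (g v) \<noteq> {}" using gim by blast
    then have le: "u $ 1 \<le> v $ 1" "u $ 2 \<le> v $ 2"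
      by (auto simp: g_def cbox_Pair_eq)
    have "measure lborel (cbox u v) = (v $ 1 - u $ 1) * (v $ 2 - u $ 2)"
      using content_cbox_cart[OF False] by (simp add: UNIV_2)
    moreover have "measure lborel (cbox (g u) (g v)) = (v $ 1 - u $ 1) * (v $ 2 - u $ 2)"
      using le by (simp add: g_def content_Pair)
    ultimately show ?thesis by (simp add: gim)
  qed (simp add: gim)
  have "((\<lambda>x. F (g x)) has_integral (1 / 1) *\<^sub>R integral (cbox (a, c) (b, d)) F) (h ` cbox (a, c) (b, d))"
    by (rule has_integral_twiddle[OF _ hg gh _ _ _ cont int])
       (use gim him in \<open>auto simp: g_def intro!: continuous_intros\<close>)
  then show ?thesis
    using integral_prod_continuous[OF assms] by (simp only: him) (simp add: g_def h_def)
qed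

text \<open>Summing the tail coefficients at the intermediate radius \<open>(1 + r) / 2\<close>
  gives a constant uniform in \<open>z\<close>. The area theorem needs this as \<open>z\<close>
  approaches 0, where \<open>q z / z\<close> has its pole.\<close>

lemma taylor_remainder_bound:
  assumes hol: "f holomorphic_on ball 0 1" and F: "f has_fps_expansion F" and r: "0 \<le> r" "r < 1"
  obtains C where "C \<ge> 0"
    "\<And>z. cmod z \<le> r \<Longrightarrow> cmod (f z - (\<Sum>n<m. fps_nth F n * z ^ n)) \<le> C * cmod z ^ m"
proof
  define C where "C = (\<Sum>n. cmod (fps_nth F (n + m)) * ((1 + r) / 2) ^ n)"
  define \<rho> where "\<rho> = (1 + r) / 2"
  have \<rho>: "0 < \<rho>" "\<rho> < 1" "r \<le> \<rho>" using r by (auto simp: \<rho>_def)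
  have "summable (\<lambda>n. cmod (fps_nth F (n + m)) * \<rho> ^ (n + m))"
    using fps_expansion_abs_summable[OF hol F, of \<rho>] \<rho> by (subst summable_iff_shift) auto
  then have "summable (\<lambda>n. cmod (fps_nth F (n + m)) * \<rho> ^ (n + m) * inverse (\<rho> ^ m))"
    by (rule summable_mult2)
  then have S: "summable (\<lambda>n. cmod (fps_nth F (n + m)) * \<rho> ^ n)"
    using \<rho> by (simp add: power_add mult.assoc)
  show "C \<ge> 0" unfolding C_def using S r by (intro suminf_nonneg) (auto simp: \<rho>_def)
  fix z assume z: "cmod z \<le> r"
  have "(\<lambda>n. fps_nth F (n + m) * z ^ (n + m)) sums (f z - (\<Sum>n<m. fps_nth F n * z ^ n))"
    using fps_expansion_sums[OF hol F, of z] z r by (intro sums_split_initial_segment) auto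
  then have "f z - (\<Sum>n<m. fps_nth F n * z ^ n) = (\<Sum>n. fps_nth F (n + m) * z ^ (n + m))"
    by (simp add: sums_iff)
  also have "cmod \<dots> \<le> (\<Sum>n. cmod (fps_nth F (n + m)) * \<rho> ^ n * cmod z ^ m)"
  proof (rule norm_suminf_le)
    fix n show "cmod (fps_nth F (n + m) * z ^ (n + m)) \<le> cmod (fps_nth F (n + m)) * \<rho> ^ n * cmod z ^ m"
      using power_mono[of "cmod z" \<rho> n] z \<rho>
      by (auto simp: norm_mult norm_power power_add mult.assoc intro!: mult_left_mono mult_right_mono)
  qed (intro summable_mult2 S)
  also have "\<dots> = C * cmod z ^ m"
    using S by (simp add: C_def \<rho>_def suminf_mult2)
  finally show "cmod (f z - (\<Sum>n<m. fps_nth F n * z ^ n)) \<le> C * cmod z ^ m" .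
qed

section \<open>The area theorem\<close>

text \<open>The region \<open>s \<le> |z| \<le> r\<close> is mapped by \<open>q z / z\<close> into a domain that, as \<open>s \<rightarrow> 0\<close>, is approximately
  an ellipse. The real linear map \<open>w - \<beta> cnj w\<close>, of determinant \<open>1 - |\<beta>|\<^sup>2\<close>, makes it
  a disc up to an error that vanishes in the limit, so no Green's formula is needed. The area is
  computed in the coordinate \<open>log z\<close>.\<close>

lemma area_distorted_image_le:
  assumes hol: "q holomorphic_on ball 0 1" and Q: "q has_fps_expansion Q" and Q0: "fps_nth Q 0 = 1"
    and inj: "inj_on (\<lambda>z. q z / z) (ball 0 1 - {0})"
    and r: "0 < s" "s < r" "r < 1" and \<beta>: "cmod \<beta> < 1"
    and R: "\<And>z. s \<le> cmod z \<Longrightarrow> cmod z \<le> r \<Longrightarrow> cmod (q z / z - \<beta> * cnj (q z / z)) < R"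
  shows "(1 - (cmod \<beta>)\<^sup>2) * (1 / s\<^sup>2 - 1 / r\<^sup>2 +
      (\<Sum>n<N. real n * (cmod (fps_nth Q (Suc n)))\<^sup>2 * (r ^ (2 * n) - s ^ (2 * n)))) \<le> R\<^sup>2"
proof -
  define \<phi> where "\<phi> = (\<lambda>z. q z / z)"
  define E where "E = (\<lambda>x::real^2. exp (Complex (x $ 1) (x $ 2)))"
  define M where "M = (\<lambda>w. w - \<beta> * cnj w)"
  define T where "T = (\<lambda>w. vector [Re w, Im w] :: real^2)"
  define \<Psi> where "\<Psi> = (\<lambda>x. T (M (\<phi> (E x))))"
  define D where "D = (\<lambda>x. E x * deriv \<phi> (E x))"
  define \<Psi>' where "\<Psi>' = (\<lambda>x (v::real^2). T (M (D x * Complex (v $ 1) (v $ 2))))"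
  define lo where "lo = (vector [ln s, - pi] :: real^2)"
  define hi where "hi = (vector [ln r, pi] :: real^2)"
  \<comment> \<open>The open box leaves out the slit along the negative axis: angles then differ by
    less than \<open>2 * pi\<close>, which makes \<open>E\<close> injective, and the omitted
    boundary does not change the integral.\<close>
  define S where "S = box lo hi"
  have nE: "cmod (E x) = exp (x $ 1)" for x by (simp add: E_def norm_exp_eq_Re)
  have range: "s \<le> cmod (E x)" "cmod (E x) \<le> r" if "x \<in> cbox lo hi" for x
  proof -
    have "ln s \<le> x $ 1" "x $ 1 \<le> ln r" using that by (auto simp: lo_def hi_def mem_box_cart forall_2)
    then have "exp (ln s) \<le> exp (x $ 1)" "exp (x $ 1) \<le> exp (ln r)" by simp_all
    then show "s \<le> cmod (E x)" "cmod (E x) \<le> r"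
      using r nE[of x] by simp_all
  qed
  have SB: "S \<subseteq> cbox lo hi" by (simp add: S_def box_subset_cbox)
  have Edom: "E x \<in> ball 0 1 - {0}" if "x \<in> cbox lo hi" for x
    using range[OF that] r by auto
  have injE: "inj_on E S"
  proof (rule inj_onI)
    fix x y assume xy: "x \<in> S" "y \<in> S" "E x = E y"
    have "- pi < z $ 2 \<and> z $ 2 < pi" if "z \<in> S" for z
      using that by (simp add: S_def lo_def hi_def mem_box_cart forall_2)
    from this[OF xy(1)] this[OF xy(2)] have "\<bar>x $ 2 - y $ 2\<bar> < 2 * pi"
      by linarith
    then have "Complex (x $ 1) (x $ 2) = Complex (y $ 1) (y $ 2)"
      using exp_complex_eqI[OF _ xy(3)[unfolded E_def]] by simp
    then have "x $ 1 = y $ 1" "x $ 2 = y $ 2" by blast+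
    then show "x = y" unfolding vec_eq_iff forall_2 by blast
  qed
  have injM: "inj M"
  proof (rule injI)
    fix w w' assume "M w = M w'"
    then have e: "w - w' = \<beta> * cnj (w - w')" by (simp add: M_def algebra_simps)
    then have "cmod (w - w') = cmod \<beta> * cmod (w - w')"
      by (metis norm_mult complex_mod_cnj)
    then show "w = w'" using \<beta> by auto
  qed
  have injT: "inj T" by (auto simp: inj_def T_def vec_eq_iff forall_2 complex_eq_iff)
  have inj\<Psi>: "inj_on \<Psi> S"
  proof (rule inj_onI)
    fix x y assume xy: "x \<in> S" "y \<in> S" "\<Psi> x = \<Psi> y"
    then have "\<phi> (E x) = \<phi> (E y)" using injM injT by (simp add: \<Psi>_def inj_eq)
    then have "E x = E y"
      using inj_onD[OF inj[folded \<phi>_def]] Edom SB xy(1,2) by blast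
    then show "x = y" using inj_onD[OF injE] xy by blast
  qed
  have hol\<phi>: "\<phi> holomorphic_on (ball 0 1 - {0})"
    unfolding \<phi>_def by (intro holomorphic_intros holomorphic_on_subset[OF hol]) auto
  have der\<phi>: "(\<phi> has_field_derivative deriv \<phi> (E x)) (at (E x))" if "x \<in> cbox lo hi" for x
    using holomorphic_derivI[OF hol\<phi> _ Edom[OF that]] by (simp add: open_Diff)
  have bl: "bounded_linear (\<lambda>v::real^2. Complex (v $ 1) (v $ 2))"
    by (intro linear_conv_bounded_linear[THEN iffD1] linearI) (auto simp: complex_eq_iff)
  have blT: "bounded_linear T"
    by (intro linear_conv_bounded_linear[THEN iffD1] linearI) (auto simp: T_def vec_eq_iff forall_2)
  have blM: "bounded_linear M"
    by (intro linear_conv_bounded_linear[THEN iffD1] linearI) (auto simp: M_def algebra_simps scaleR_conv_of_real)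
  have der: "(\<Psi> has_derivative \<Psi>' x) (at x within S)" if "x \<in> S" for x
  proof -
    have x: "x \<in> cbox lo hi" using that SB by auto
    have "(E has_derivative (\<lambda>v. E x * Complex (v $ 1) (v $ 2))) (at x within S)"
      unfolding E_def
      by (rule has_derivative_compose[OF bounded_linear_imp_has_derivative[OF bl], where g = exp])
         (use DERIV_exp[of "Complex (x $ 1) (x $ 2)"] in \<open>simp add: has_field_derivative_def\<close>)
    then have "((\<lambda>x. \<phi> (E x)) has_derivative (\<lambda>v. deriv \<phi> (E x) * (E x * Complex (v $ 1) (v $ 2)))) (at x within S)"
      by (rule has_derivative_compose) (use der\<phi>[OF x] in \<open>simp add: has_field_derivative_def\<close>)
    from bounded_linear.has_derivative[OF blT bounded_linear.has_derivative[OF blM this]]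
    show ?thesis unfolding \<Psi>_def \<Psi>'_def D_def by (simp add: mult_ac)
  qed
  have det: "\<bar>det (matrix (\<Psi>' x))\<bar> = (1 - (cmod \<beta>)\<^sup>2) * (cmod (D x))\<^sup>2" for x
  proof -
    have "(axis i 1 :: real^2) $ j = (if i = j then 1 else 0)" for i j by (simp add: axis_def)
    moreover have "Complex 1 0 = 1" "Complex 0 1 = \<i>" by (auto simp: complex_eq_iff)
    ultimately have "det (matrix (\<Psi>' x)) = Re (M (D x)) * Im (M (D x * \<i>)) - Re (M (D x * \<i>)) * Im (M (D x))"
      by (simp add: det_2 matrix_def \<Psi>'_def T_def)
    also have "\<dots> = (1 - (cmod \<beta>)\<^sup>2) * (cmod (D x))\<^sup>2"
      unfolding M_def cmod_power2 by (simp add: power2_eq_square algebra_simps)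
    moreover have "(cmod \<beta>)\<^sup>2 \<le> 1" using \<beta> by (simp add: power_le_one)
    ultimately show ?thesis by simp
  qed
  \<comment> \<open>The derivative of \<open>\<phi>\<close> is \<open>q2 z / z\<^sup>2\<close>: with
    the double pole split off, the numerator is holomorphic with coefficients
    \<open>(n - 1) Q_n\<close>, and Parseval applies to it circle by circle.\<close>
  define q2 where "q2 = (\<lambda>z. z * deriv q z - q z)"
  have holq2: "q2 holomorphic_on ball 0 1"
    unfolding q2_def by (intro holomorphic_intros hol) auto
  have expq2: "q2 has_fps_expansion (fps_X * fps_deriv Q - Q)"
    unfolding q2_def by (intro fps_expansion_intros Q)
  have cq2: "fps_nth (fps_X * fps_deriv Q - Q) n = (of_nat n - 1) * fps_nth Q n" for n
    by (cases n) (auto simp: algebra_simps)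
  have d\<phi>: "deriv \<phi> z = q2 z / z\<^sup>2" if "z \<in> ball 0 1 - {0}" for z
  proof -
    have "(q has_field_derivative deriv q z) (at z)"
      using holomorphic_derivI[OF hol, of z] that by auto
    then show ?thesis unfolding \<phi>_def q2_def using that
      by (intro DERIV_imp_deriv) (auto intro!: derivative_eq_intros simp: field_simps power2_eq_square)
  qed
  \<comment> \<open>In \<open>D\<close>, \<open>E\<close> contributes the factor \<open>|z|\<close>
    and the derivative of \<open>\<phi>\<close> contributes \<open>|q2| / |z|^2\<close>, so
    \<open>|D|^2 = |q2|^2 / |z|^2\<close> with \<open>|z| = exp u\<close>.\<close>
  define G where "G = (\<lambda>(u,t). (1 - (cmod \<beta>)\<^sup>2) * (exp (-2 * u) * (cmod (q2 (of_real (exp u) * cis t)))\<^sup>2))"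
  have G: "(1 - (cmod \<beta>)\<^sup>2) * (cmod (D x))\<^sup>2 = G (x $ 1, x $ 2)" if "x \<in> cbox lo hi" for x
  proof -
    have "E x = of_real (exp (x $ 1)) * cis (x $ 2)" by (simp add: E_def exp_eq_polar exp_of_real)
    moreover have "cmod (D x) = cmod (q2 (E x)) / exp (x $ 1)"
      using Edom[OF that] unfolding D_def d\<phi>[OF Edom[OF that]]
      by (simp add: norm_mult norm_divide norm_power nE power2_eq_square)
    moreover have "exp (- 2 * (x $ 1)) = 1 / (exp (x $ 1))\<^sup>2"
      by (simp add: exp_minus exp_double divide_inverse)
    ultimately show ?thesis
      by (simp add: G_def power_divide)
  qed
  have contG: "continuous_on (cbox (ln s, - pi) (ln r, pi)) G"
  proof -
    have "continuous_on (cbox (ln s, - pi) (ln r, pi)) (\<lambda>p. q2 (of_real (exp (fst p)) * cis (snd p)))"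
    proof (rule continuous_on_compose2[OF holomorphic_on_imp_continuous_on[OF holq2]])
      show "continuous_on (cbox (ln s, - pi) (ln r, pi)) (\<lambda>p. complex_of_real (exp (fst p)) * cis (snd p))"
        by (intro continuous_intros)
      have "exp u < 1" if "u \<le> ln r" for u :: real
      proof -
        have "ln r < 0" using r by simp
        then show ?thesis using that by simp
      qed
      then show "(\<lambda>p. complex_of_real (exp (fst p)) * cis (snd p)) ` cbox (ln s, - pi) (ln r, pi) \<subseteq> ball 0 1"
        by (auto simp: cbox_Pair_eq norm_mult)
    qed
    then show ?thesis unfolding G_def case_prod_unfold by (intro continuous_intros)
  qed
  define A where "A = integral {ln s..ln r} (\<lambda>u. integral {-pi..pi} (\<lambda>t. G (u, t)))"
  have "((\<lambda>x. G (x $ 1, x $ 2)) has_integral A) (cbox lo hi)"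
    unfolding A_def lo_def hi_def by (rule integral_cart2_continuous[OF contG])
  then have "((\<lambda>x. \<bar>det (matrix (\<Psi>' x))\<bar>) has_integral A) (cbox lo hi)"
    by (rule has_integral_eq[rotated]) (simp add: det G)
  then have "((\<lambda>x. \<bar>det (matrix (\<Psi>' x))\<bar>) has_integral A) S"
    unfolding S_def by (simp add: has_integral_open_interval)
  then have meas: "\<Psi> ` S \<in> lmeasurable" "measure lebesgue (\<Psi> ` S) = A"
    using has_measure_differentiable_image[OF _ der inj\<Psi>] by (auto simp: S_def)
  have "R > 0"
    by (rule le_less_trans[OF norm_ge_zero R[of "of_real r"]]) (use r in auto)
  have "\<Psi> ` S \<subseteq> ball 0 R"
  proof
    fix y assume "y \<in> \<Psi> ` S"
    then obtain x where x: "x \<in> S" "y = T (M (\<phi> (E x)))" by (auto simp: \<Psi>_def)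
    have "cmod (M (\<phi> (E x))) < R" unfolding M_def \<phi>_def using R range x(1) SB by blast
    moreover have "norm (T w) = cmod w" for w
      by (simp add: T_def norm_vec_def L2_set_def sum_2 cmod_def)
    ultimately show "y \<in> ball 0 R" using x by simp
  qed
  then have "A \<le> measure lebesgue (ball (0::real^2) R)"
    using meas by (metis measure_mono_fmeasurable lmeasurable_ball fmeasurableD)
  then have Ale: "A \<le> pi * R\<^sup>2"
    using circle_area[of R "0::real^2"] \<open>R > 0\<close> by (simp add: mult.commute)
  define b where "b = (\<lambda>n. real n * real n * (cmod (fps_nth Q (Suc n)))\<^sup>2)"
  \<comment> \<open>A lower bound for the inner integral: the Parseval series of \<open>q2\<close>,
    cut off after index \<open>N\<close>. Index 0 gives the pole term \<open>exp (-2 u)\<close>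
    because \<open>(0 - 1) Q_0 = -1\<close>; index \<open>Suc n\<close> gives the term with
    \<open>b n\<close>.\<close>
  define L where "L = (\<lambda>u. (1 - (cmod \<beta>)\<^sup>2) * (2 * pi * (exp (-2 * u) + (\<Sum>n<N. b n * exp (2 * real n * u)))))"
  have Lle: "L u \<le> integral {-pi..pi} (\<lambda>t. G (u, t))" if u: "u \<in> {ln s..ln r}" for u
  proof -
    have "ln r < 0" using r by simp
    then have eu: "exp u < 1" using u by simp
    define p where "p = (\<lambda>n. (cmod ((of_nat n - 1) * fps_nth Q n))\<^sup>2 * exp u ^ (2 * n))"
    define I where "I = integral {-pi..pi} (\<lambda>t. (cmod (q2 (of_real (exp u) * cis t)))\<^sup>2)"
    have "p sums (I / (2 * pi))"
      using parseval_circle(1)[OF holq2 expq2 _ eu] unfolding p_def I_def cq2 by simp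
    then have "(\<Sum>n<Suc N. p n) \<le> I / (2 * pi)"
      using sum_le_suminf[of p "{..<Suc N}"] by (auto simp: sums_iff p_def)
    then have "2 * pi * (\<Sum>n<Suc N. p n) \<le> I"
      by (simp add: pos_le_divide_eq mult.commute del: sum.lessThan_Suc)
    moreover have "(\<Sum>n<Suc N. p n) = 1 + (\<Sum>n<N. b n * exp (2 * real n * u) * exp (2 * u))"
      unfolding sum.lessThan_Suc_shift
      by (simp add: p_def b_def Q0 norm_mult power_mult_distrib flip: exp_of_nat_mult exp_add)
         (simp add: power2_eq_square exp_add algebra_simps)
    ultimately have "2 * pi * (1 + (\<Sum>n<N. b n * exp (2 * real n * u)) * exp (2 * u)) \<le> I"
      by (simp only: sum_distrib_right)
    then have "exp (-2 * u) * (2 * pi * (1 + (\<Sum>n<N. b n * exp (2 * real n * u)) * exp (2 * u))) \<le> exp (-2 * u) * I"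
      by (rule mult_left_mono) simp
    moreover have "exp (-2 * u) * (2 * pi * (1 + y * exp (2 * u))) = 2 * pi * (exp (-2 * u) + y)" for y
      by (simp add: exp_minus field_simps)
    ultimately have "2 * pi * (exp (-2 * u) + (\<Sum>n<N. b n * exp (2 * real n * u))) \<le> exp (-2 * u) * I"
      by (simp only:)
    then have "L u \<le> (1 - (cmod \<beta>)\<^sup>2) * (exp (-2 * u) * I)"
      unfolding L_def using \<beta> by (intro mult_left_mono) (auto simp: power_le_one)
    then show ?thesis by (simp add: G_def I_def mult.assoc)
  qed
  have "(L has_integral ((1 - (cmod \<beta>)\<^sup>2) * (2 * pi * ((1 / s\<^sup>2 - 1 / r\<^sup>2) / 2 +
     (\<Sum>n<N. real n * (cmod (fps_nth Q (Suc n)))\<^sup>2 * (r ^ (2 * n) - s ^ (2 * n)) / 2))))) {ln s..ln r}"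
    unfolding L_def
  proof (intro has_integral_mult_right has_integral_add has_integral_sum)
    have le: "ln s \<le> ln r" using r by simp
    have pw: "exp (2 * (real n * ln x)) = x ^ (2 * n)" if "x > 0" for x :: real and n
      using that exp_of_nat_mult[of "2 * n" "ln x"] by (simp add: mult.assoc)
    show "((\<lambda>u. exp (-2 * u)) has_integral (1 / s\<^sup>2 - 1 / r\<^sup>2) / 2) {ln s..ln r}"
    proof -
      have "((\<lambda>u. exp (-2 * u)) has_integral (- exp (-2 * ln r) / 2 - - exp (-2 * ln s) / 2)) {ln s..ln r}"
        by (rule fundamental_theorem_of_calculus[OF le])
           (auto intro!: derivative_eq_intros simp flip: has_real_derivative_iff_has_vector_derivative)
      moreover have "exp (- (2 * ln x)) = 1 / x\<^sup>2" if "x > 0" for x :: real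
        using that pw[of x 1] by (simp add: exp_minus field_simps power2_eq_square)
      ultimately show ?thesis using r by (simp add: diff_divide_distrib)
    qed
    fix n
    show "((\<lambda>u. b n * exp (2 * real n * u)) has_integral
       real n * (cmod (fps_nth Q (Suc n)))\<^sup>2 * (r ^ (2 * n) - s ^ (2 * n)) / 2) {ln s..ln r}"
    proof (cases "n = 0")
      case False
      have "((\<lambda>u. b n * exp (2 * real n * u)) has_integral
         (b n * exp (2 * real n * ln r) / (2 * real n) - b n * exp (2 * real n * ln s) / (2 * real n))) {ln s..ln r}"
        by (rule fundamental_theorem_of_calculus[OF le])
           (use False in \<open>auto intro!: derivative_eq_intros simp flip: has_real_derivative_iff_has_vector_derivative\<close>)
      then show ?thesis using r False pw[of r n] pw[of s n]
        by (simp add: b_def field_simps)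
    qed (simp add: b_def)
  qed auto
  moreover have "(\<lambda>u. integral {-pi..pi} (\<lambda>t. G (u, t))) integrable_on {ln s..ln r}"
    using integral_integrable_2dim[OF contG] by (simp add: cbox_interval)
  ultimately have le: "(1 - (cmod \<beta>)\<^sup>2) * (2 * pi * ((1 / s\<^sup>2 - 1 / r\<^sup>2) / 2 +
     (\<Sum>n<N. real n * (cmod (fps_nth Q (Suc n)))\<^sup>2 * (r ^ (2 * n) - s ^ (2 * n)) / 2))) \<le> A"
    unfolding A_def by (rule has_integral_le[OF _ integrable_integral Lle])
  have eq: "c * (2 * pi * (x / 2 + (\<Sum>n<N. y n / 2))) = pi * (c * (x + (\<Sum>n<N. y n)))" for c x y
    by (simp add: sum_divide_distrib[symmetric] algebra_simps)
  have "pi * ((1 - (cmod \<beta>)\<^sup>2) * (1 / s\<^sup>2 - 1 / r\<^sup>2 +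
      (\<Sum>n<N. real n * (cmod (fps_nth Q (Suc n)))\<^sup>2 * (r ^ (2 * n) - s ^ (2 * n))))) \<le> pi * R\<^sup>2"
    using order.trans[OF le Ale] unfolding eq .
  then show ?thesis by simp
qed

text \<open>Gronwall's area theorem for a map with its simple pole at 0 instead of infinity;
  \<open>Q1\<close> centres the images of small circles at the origin. In
  \<open>area_distorted_image_le\<close> with the matching \<open>\<beta>\<close> the leading term
  \<open>1 / s\<^sup>2\<close> occurs on both sides and cancels; then \<open>s\<close> tends to 0
  and \<open>r\<close> to 1.\<close>

lemma area_theorem:
  assumes hol: "q holomorphic_on ball 0 1" and Q: "q has_fps_expansion Q"
    and Q0: "fps_nth Q 0 = 1" and Q1: "fps_nth Q 1 = 0"
    and inj: "inj_on (\<lambda>z. q z / z) (ball 0 1 - {0})"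
  shows "(\<Sum>n<N. real n * (cmod (fps_nth Q (Suc n)))\<^sup>2) \<le> 1"
proof -
  define c where "c = (\<lambda>n. (cmod (fps_nth Q (Suc n)))\<^sup>2)"
  define a where "a = cmod (fps_nth Q 2)"
  define X where "X = (\<lambda>r s. \<Sum>n<N. real n * c n * (r ^ (2 * n) - s ^ (2 * n)))"
  have sum3: "(\<Sum>n<3. fps_nth Q n * z ^ n) = 1 + fps_nth Q 2 * z\<^sup>2" for z
    using Q0 Q1 by (simp add: eval_nat_numeral)
  have main: "X r 0 \<le> 1 / r\<^sup>2" if r: "0 < r" "r < 1" for r
  proof -
    obtain C where C: "C \<ge> 0" "\<And>z. cmod z \<le> r \<Longrightarrow> cmod (q z - (1 + fps_nth Q 2 * z\<^sup>2)) \<le> C * cmod z ^ 3"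
      using taylor_remainder_bound[OF hol Q, of r 3] r unfolding sum3 by (metis less_imp_le)
    \<comment> \<open>The condition \<open>s * B < 1\<close> serves twice: it forces
      \<open>cmod \<beta> < 1\<close>, and it makes the estimate below largest on the inner circle
      \<open>cmod z = s\<close>. The final 1 in \<open>E\<close> makes that estimate strict.\<close>
    define B where "B = 2 * a + 4 * C + a\<^sup>2 + 1"
    have B: "B \<ge> 1" "a \<ge> 0" using C(1) by (auto simp: B_def a_def)
    define E where "E = a\<^sup>2 + 2 * C + 1"
    have ineq: "(1 - a\<^sup>2 * s ^ 4) * (1 / s\<^sup>2 - 1 / r\<^sup>2 + X r s) \<le> (1 / s + E * s\<^sup>2)\<^sup>2"
      if s: "0 < s" "s < r" "s * B < 1" for s
    proof -
      \<comment> \<open>On \<open>cmod z = s\<close> one has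
        \<open>cnj (1 / z) = z / s\<^sup>2\<close>, so \<open>\<beta> * cnj (1 / z)\<close> cancels
        the linear term \<open>fps_nth Q 2 * z\<close> and leaves a circle of radius
        \<open>1 / s\<close> up to an error of order \<open>s\<^sup>2\<close>.\<close>
      define \<beta> where "\<beta> = fps_nth Q 2 * of_real (s\<^sup>2)"
      have n\<beta>: "cmod \<beta> = a * s\<^sup>2" using s by (simp add: \<beta>_def a_def norm_mult norm_power)
      have sB: "s * a < 1"
      proof -
        have "s * a \<le> s * B" using s B C(1) by (intro mult_left_mono) (auto simp: B_def)
        then show ?thesis using s(3) by linarith
      qed
      have \<beta>1: "cmod \<beta> < 1"
      proof -
        have "a * s\<^sup>2 = (s * a) * s" by (simp add: power2_eq_square)
        also have "\<dots> \<le> (s * a) * 1" using s r B by (intro mult_left_mono) auto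
        finally show ?thesis using sB n\<beta> by simp
      qed
      have bound: "cmod (q z / z - \<beta> * cnj (q z / z)) < 1 / s + E * s\<^sup>2"
        if z: "s \<le> cmod z" "cmod z \<le> r" for z
      proof -
        define t where "t = cmod z"
        have t: "s \<le> t" "t \<le> r" "t > 0" using z s by (auto simp: t_def)
        have z0: "z \<noteq> 0" using t by (auto simp: t_def)
        define e where "e = (q z - (1 + fps_nth Q 2 * z\<^sup>2)) / z"
        have "cmod e \<le> C * t ^ 3 / t"
          unfolding e_def norm_divide t_def[symmetric]
          using C(2)[of z] z t by (intro divide_right_mono) (auto simp: t_def)
        then have e: "cmod e \<le> C * t\<^sup>2" using t by (simp add: power3_eq_cube power2_eq_square)
        have qz: "q z / z = 1 / z + fps_nth Q 2 * z + e"
          using z0 by (simp add: e_def field_simps power2_eq_square)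
        have cnjz: "1 / cnj z = z / of_real (t\<^sup>2)"
        proof -
          have "of_real (t\<^sup>2) = z * cnj z" unfolding t_def by (rule complex_norm_square)
          then show ?thesis using z0 by simp
        qed
        have "q z / z - \<beta> * cnj (q z / z) =
            1 / z + fps_nth Q 2 * z * of_real (1 - s\<^sup>2 / t\<^sup>2) - \<beta> * cnj (fps_nth Q 2 * z) + e - \<beta> * cnj e"
          unfolding qz using cnjz by (simp add: \<beta>_def algebra_simps)
        also have "cmod \<dots> \<le> cmod (1 / z) + cmod (fps_nth Q 2 * z * of_real (1 - s\<^sup>2 / t\<^sup>2))
             + cmod (\<beta> * cnj (fps_nth Q 2 * z)) + cmod e + cmod (\<beta> * cnj e)"
          by (intro order.trans[OF norm_triangle_ineq4] order.trans[OF norm_triangle_ineq] add_mono order_refl)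
        also have "\<dots> = 1 / t + a * t * \<bar>1 - s\<^sup>2 / t\<^sup>2\<bar> + a * s\<^sup>2 * (a * t) + cmod e + a * s\<^sup>2 * cmod e"
          by (simp only: norm_mult norm_divide norm_of_real complex_mod_cnj n\<beta> t_def[symmetric] a_def[symmetric] norm_one)
        also have "\<bar>1 - s\<^sup>2 / t\<^sup>2\<bar> = 1 - s\<^sup>2 / t\<^sup>2"
          using t s by (simp add: power_mono)
        also have "a * s\<^sup>2 * cmod e \<le> 1 * cmod e"
          using \<beta>1 n\<beta> by (intro mult_right_mono) auto
        also have "a * s\<^sup>2 * (a * t) \<le> a * s\<^sup>2 * (a * 1)"
          using t r B s by (intro mult_left_mono) auto
        finally have "cmod (q z / z - \<beta> * cnj (q z / z))
           \<le> 1 / t + a * t * (1 - s\<^sup>2 / t\<^sup>2) + a * s\<^sup>2 * (a * 1) + cmod e + 1 * cmod e"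
          by - simp
        moreover have "a * s\<^sup>2 * (a * 1) = a\<^sup>2 * s\<^sup>2" by (simp add: power2_eq_square)
        ultimately have 1: "cmod (q z / z - \<beta> * cnj (q z / z))
           \<le> 1 / t + a * t * (1 - s\<^sup>2 / t\<^sup>2) + a\<^sup>2 * s\<^sup>2 + 2 * C * t\<^sup>2"
          using e by linarith
        have "a * (t + s) + 2 * C * t * (t + s) \<le> a * 2 + 2 * C * 1 * 2"
          using t r s B C by (intro add_mono mult_left_mono mult_mono) auto
        also have "\<dots> \<le> B" by (simp add: B_def)
        also have "\<dots> \<le> 1 / s" using s by (simp add: field_simps)
        \<comment> \<open>The bound at \<open>t = s\<close> minus the bound at \<open>t\<close> has
          the factor \<open>(t - s) / t\<close>; the other factor is nonnegative by the choice of
          \<open>B\<close>.\<close>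
        finally have "0 \<le> (t - s) / t * (1 / s - (a * (t + s) + 2 * C * t * (t + s)))"
          using t by (intro mult_nonneg_nonneg) auto
        also have "\<dots> = 1 / s - 1 / t - a * t * (1 - s\<^sup>2 / t\<^sup>2) - 2 * C * t\<^sup>2 + 2 * C * s\<^sup>2"
          using t s by (simp add: field_simps power2_eq_square)
        finally have "1 / t + a * t * (1 - s\<^sup>2 / t\<^sup>2) + 2 * C * t\<^sup>2 \<le> 1 / s + 2 * C * s\<^sup>2" by simp
        with 1 have "cmod (q z / z - \<beta> * cnj (q z / z)) \<le> 1 / s + (a\<^sup>2 + 2 * C) * s\<^sup>2"
          by (simp add: algebra_simps)
        also have "\<dots> < 1 / s + E * s\<^sup>2"
          using s by (simp add: E_def algebra_simps)
        finally show ?thesis .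
      qed
      show ?thesis
        using area_distorted_image_le[OF hol Q Q0 inj s(1,2) r(2) \<beta>1 bound, of N]
        by (simp add: X_def c_def n\<beta> power_mult_distrib flip: power_mult)
    qed
    have ineq2: "(1 - a\<^sup>2 * s ^ 4) * (X r s - 1 / r\<^sup>2) - a\<^sup>2 * s\<^sup>2 \<le> 2 * E * s + E\<^sup>2 * s ^ 4"
      if s: "0 < s" "s < r" "s * B < 1" for s
    proof -
      have "(1 - a\<^sup>2 * s ^ 4) * (1 / s\<^sup>2 - 1 / r\<^sup>2 + X r s) =
         (1 - a\<^sup>2 * s ^ 4) * (X r s - 1 / r\<^sup>2) - a\<^sup>2 * s\<^sup>2 + 1 / s\<^sup>2"
        using s by (simp add: algebra_simps power2_eq_square power4_eq_xxxx)
      moreover have "(1 / s + E * s\<^sup>2)\<^sup>2 = 2 * E * s + E\<^sup>2 * s ^ 4 + 1 / s\<^sup>2"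
        using s by (simp add: power2_eq_square power4_eq_xxxx field_simps)
      ultimately show ?thesis using ineq[OF s] by linarith
    qed
    have ev: "eventually (\<lambda>s. 0 < s \<and> s < r \<and> s * B < 1) (at_right (0::real))"
      unfolding eventually_at_right_field
      by (rule exI[of _ "min r (1 / B)"]) (use r B in \<open>auto simp: field_simps\<close>)
    have cont: "continuous (at_right 0) (X r)"
      unfolding X_def by (intro continuous_intros)
    have lim1: "((\<lambda>s. (1 - a\<^sup>2 * s ^ 4) * (X r s - 1 / r\<^sup>2) - a\<^sup>2 * s\<^sup>2) \<longlongrightarrow>
        (1 - a\<^sup>2 * 0 ^ 4) * (X r 0 - 1 / r\<^sup>2) - a\<^sup>2 * 0\<^sup>2) (at_right 0)"
      by (intro tendsto_intros cont[unfolded continuous_within])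
    have lim2: "((\<lambda>s. 2 * E * s + E\<^sup>2 * s ^ 4) \<longlongrightarrow> 2 * E * 0 + E\<^sup>2 * 0 ^ 4) (at_right 0)"
      by (intro tendsto_intros)
    have "(1 - a\<^sup>2 * 0 ^ 4) * (X r 0 - 1 / r\<^sup>2) - a\<^sup>2 * 0\<^sup>2 \<le> 2 * E * 0 + E\<^sup>2 * 0 ^ 4"
      by (rule tendsto_le[OF trivial_limit_at_right_real lim2 lim1])
         (rule eventually_mono[OF ev], use ineq2 in auto)
    then show ?thesis by simp
  qed
  have "eventually (\<lambda>r. 0 < r \<and> r < 1) (at_left (1::real))"
    unfolding eventually_at_left_field by (rule exI[of _ 0]) auto
  then have ev: "eventually (\<lambda>r. X r 0 \<le> 1 / r\<^sup>2) (at_left 1)"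
    by eventually_elim (use main in auto)
  have "((\<lambda>r. X r 0) \<longlongrightarrow> X 1 0) (at_left 1)"
    unfolding X_def by (intro tendsto_intros)
  moreover have "((\<lambda>r. 1 / r\<^sup>2) \<longlongrightarrow> 1 / (1::real)\<^sup>2) (at_left 1)"
    by (intro tendsto_intros) auto
  ultimately have "X 1 0 \<le> 1 / (1::real)\<^sup>2"
    using ev by (intro tendsto_le[OF trivial_limit_at_left_real])
  moreover have "X 1 0 = (\<Sum>n<N. real n * c n)"
    unfolding X_def by (intro sum.cong) auto
  ultimately show ?thesis by (simp add: c_def)
qed

section \<open>Univalent functions\<close>

definition schlicht :: "(complex \<Rightarrow> complex) \<Rightarrow> bool" where
  "schlicht f \<longleftrightarrow> f holomorphic_on ball 0 1 \<and> inj_on f (ball 0 1) \<and> f 0 = 0 \<and> deriv f 0 = 1"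

lemma fps_expansion_mult_eq:
  assumes "f has_fps_expansion F" "g has_fps_expansion G" "h has_fps_expansion H"
    and "\<And>z::complex. cmod z < 1 \<Longrightarrow> f z * g z = h z"
  shows "F * G = H"
proof -
  have "(\<lambda>z. f z * g z) has_fps_expansion F * G" by (intro fps_expansion_intros assms)
  moreover have "eventually (\<lambda>z::complex. z \<in> ball 0 1) (nhds 0)"
    by (intro eventually_nhds_in_open) auto
  then have "eventually (\<lambda>z. f z * g z = h z) (nhds 0)"
    by eventually_elim (use assms(4) in auto)
  ultimately have "h has_fps_expansion F * G" by (simp add: has_fps_expansion_cong)
  then show ?thesis using assms(3) fps_expansion_unique_complex by blast
qed

lemma fps_expansion_nth_low:
  fixes f :: "complex \<Rightarrow> complex"
  assumes "f has_fps_expansion F"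
  shows "fps_nth F 0 = f 0" "fps_nth F (Suc 0) = deriv f 0" "fps_nth F 2 = deriv (deriv f) 0 / 2"
  using fps_nth_fps_expansion[OF assms] by (auto simp: eval_nat_numeral)

lemma holomorphic_has_fps_expansion:
  assumes "f holomorphic_on ball 0 1"
  shows "f has_fps_expansion fps_expansion f 0"
  using assms by (intro has_fps_expansion_fps_expansion[of "ball 0 1"]) auto

text \<open>\<open>q\<close> is the branch of \<open>sqrt (z / f z)\<close> with value 1 at 0. Then
  \<open>q (z\<^sup>2) / z\<close> is the reciprocal of the odd square-root transform of
  \<open>f\<close>, injective on the punctured disc, and the area theorem applies to it. There
  \<open>fps_nth Q (Suc n)\<close> belongs to the power \<open>2 * n + 1\<close>, whence the
  weights.\<close>

lemma schlicht_inverse_sqrt: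
  assumes "schlicht f" and F: "f has_fps_expansion F"
  obtains q Q where "q holomorphic_on ball 0 1" "q has_fps_expansion Q" "fps_nth Q 0 = 1"
    "\<And>z. cmod z < 1 \<Longrightarrow> q z \<noteq> 0" "\<And>z. cmod z < 1 \<Longrightarrow> f z * (q z)\<^sup>2 = z"
    "fps_nth F 2 = - 2 * fps_nth Q 1"
    "\<And>N. (\<Sum>n<N. real (2 * n + 1) * (cmod (fps_nth Q (Suc n)))\<^sup>2) \<le> 1"
proof -
  have hol: "f holomorphic_on ball 0 1" and inj: "inj_on f (ball 0 1)" and f0: "f 0 = 0" "deriv f 0 = 1"
    using assms(1) by (auto simp: schlicht_def)
  obtain p where p: "p holomorphic_on ball 0 1" "\<And>z. cmod z < 1 \<Longrightarrow> f z = z * p z" "deriv f 0 = p 0"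
    using Schwarz3[OF hol f0(1)] by blast
  have p0: "p z \<noteq> 0" if "cmod z < 1" for z
  proof (cases "z = 0")
    case False
    then have "f z \<noteq> f 0" using inj_onD[OF inj, of z 0] that by auto
    then show ?thesis using p(2)[OF that] f0 by auto
  qed (use p(3) f0 in auto)
  have "(\<lambda>z. inverse (p z)) holomorphic_on ball 0 1"
    using p0 by (intro holomorphic_intros p(1)) auto
  moreover have "simply_connected (ball (0::complex) 1)" by (intro convex_imp_simply_connected) auto
  ultimately obtain q0 where q0: "q0 holomorphic_on ball 0 1" "\<And>z. cmod z < 1 \<Longrightarrow> inverse (p z) = (q0 z)\<^sup>2"
    using simply_connected_eq_holomorphic_sqrt[of "ball (0::complex) 1"] p0 by auto
  have q00: "(q0 0)\<^sup>2 = 1" using q0(2)[of 0] p(3) f0 by simp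
  define q where "q = (\<lambda>z. q0 z / q0 0)"
  have holq: "q holomorphic_on ball 0 1" using q00 unfolding q_def by (intro holomorphic_intros q0(1)) auto
  have q2: "(q z)\<^sup>2 = inverse (p z)" if "cmod z < 1" for z
    using q0(2)[OF that] q00 by (simp add: q_def power_divide)
  define Q where "Q = fps_expansion q 0"
  have Q: "q has_fps_expansion Q" unfolding Q_def by (rule holomorphic_has_fps_expansion[OF holq])
  have qn0: "q z \<noteq> 0" if "cmod z < 1" for z
    using q2[OF that] p0[OF that] by auto
  have fq: "f z * (q z)\<^sup>2 = z" if "cmod z < 1" for z
    using q2[OF that] p0[OF that] p(2)[OF that] by simp
  have Q0: "fps_nth Q 0 = 1" using fps_expansion_nth_low(1)[OF Q] q00 by (auto simp: q_def)
  \<comment> \<open>The coefficient of \<open>z\<^sup>2\<close> in this identity is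
    \<open>fps_nth F 2 + 2 * fps_nth Q 1\<close>, so the latter vanishes.\<close>
  have "F * Q\<^sup>2 = fps_X"
    by (rule fps_expansion_mult_eq[OF F has_fps_expansion_power[OF Q] has_fps_expansion_fps_X]) (use fq in auto)
  then have "fps_nth (F * Q\<^sup>2) 2 = 0" by simp
  then have F2: "fps_nth F 2 = - 2 * fps_nth Q 1"
    using Q0 fps_expansion_nth_low[OF F] f0
    by (simp add: fps_mult_nth eval_nat_numeral algebra_simps add_eq_0_iff)
  define c where "c = (\<lambda>n. if even n then fps_nth Q (n div 2) else 0)"
  have hol2: "(\<lambda>z. q (z\<^sup>2)) holomorphic_on ball 0 1"
    by (rule holomorphic_on_compose_gen[OF _ holq, unfolded o_def])
       (auto intro!: holomorphic_intros simp: norm_power power_less_one_iff)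
  have c: "(\<lambda>z. q (z\<^sup>2)) has_fps_expansion Abs_fps c"
  proof (rule sums_imp_has_fps_expansion)
    fix z :: complex assume "cmod z < 1"
    then have "(\<lambda>n. fps_nth Q n * (z\<^sup>2) ^ n) sums q (z\<^sup>2)"
      by (intro fps_expansion_sums[OF holq Q]) (auto simp: norm_power power_less_one_iff)
    moreover have "(\<lambda>n. fps_nth Q n * (z\<^sup>2) ^ n) = (\<lambda>n. c (2 * n) * z ^ (2 * n))"
      by (simp add: c_def power_mult)
    moreover have "(\<lambda>n. c (2 * n) * z ^ (2 * n)) sums q (z\<^sup>2) \<longleftrightarrow> (\<lambda>n. c n * z ^ n) sums q (z\<^sup>2)"
      by (rule sums_mono_reindex) (auto simp: strict_mono_def c_def elim!: evenE)
    ultimately show "(\<lambda>n. c n * z ^ n) sums q (z\<^sup>2)" by simp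
  qed
  have inj2: "inj_on (\<lambda>z. q (z\<^sup>2) / z) (ball 0 1 - {0})"
  proof (rule inj_onI)
    fix z w assume zw: "z \<in> ball 0 1 - {0}" "w \<in> ball 0 1 - {0}" "q (z\<^sup>2) / z = q (w\<^sup>2) / w"
    have n: "cmod (z\<^sup>2) < 1" "cmod (w\<^sup>2) < 1"
      using zw by (auto simp: norm_power power_less_one_iff)
    have key: "f (x\<^sup>2) = inverse ((q (x\<^sup>2) / x)\<^sup>2)" if "cmod (x\<^sup>2) < 1" "x \<noteq> 0" for x
      using fq[OF that(1)] qn0[OF that(1)] that(2) by (simp add: field_simps)
    have "f (z\<^sup>2) = f (w\<^sup>2)" using key[of z] key[of w] n zw by simp
    then have "z\<^sup>2 = w\<^sup>2" using inj_onD[OF inj] n by (auto simp: dist_norm)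
    \<comment> \<open>The alternative \<open>z = - w\<close> is excluded because
      \<open>q (z\<^sup>2) / z\<close> is odd and has no zero.\<close>
    moreover from this have "z = w \<or> z = - w" by (simp add: power2_eq_iff)
    ultimately show "z = w" using zw qn0[OF n(1)] by auto
  qed
  have "(\<Sum>n<N. real (2 * n + 1) * (cmod (fps_nth Q (Suc n)))\<^sup>2) \<le> 1" for N
  proof -
    have "(\<Sum>n<N. real (2 * n + 1) * (cmod (fps_nth Q (Suc n)))\<^sup>2)
        = (\<Sum>n<2*N. real n * (cmod (fps_nth (Abs_fps c) (Suc n)))\<^sup>2)"
      by (induction N) (simp_all add: c_def)
    also have "\<dots> \<le> 1"
      by (rule area_theorem[OF hol2 c _ _ inj2]) (auto simp: c_def Q0)
    finally show ?thesis .
  qed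
  with that[OF holq Q Q0 qn0 fq F2] show thesis by blast
qed

text \<open>Bieberbach's inequality: \<open>fps_nth Q 1\<close> alone is the first term of the area
  sum, with weight 1.\<close>

lemma schlicht_second_coeff_le:
  assumes "schlicht f" and F: "f has_fps_expansion F"
  shows "cmod (fps_nth F 2) \<le> 2"
proof -
  obtain Q :: "complex fps" where Q: "fps_nth F 2 = - 2 * fps_nth Q 1"
    "\<And>N. (\<Sum>n<N. real (2 * n + 1) * (cmod (fps_nth Q (Suc n)))\<^sup>2) \<le> 1"
    using schlicht_inverse_sqrt[OF assms] by metis
  have "(cmod (fps_nth Q 1))\<^sup>2 \<le> 1" using Q(2)[of 1] by simp
  then have "cmod (fps_nth Q 1) \<le> 1" by (simp add: power_le_one_iff abs_square_le_1)
  then show ?thesis using Q(1) by (simp add: norm_mult)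
qed

section \<open>Consequences of Bieberbach's inequality: omitted values, distortion, growth\<close>

lemma univalent_deriv_nonzero:
  assumes "f holomorphic_on ball 0 1" "inj_on f (ball 0 1)" "cmod z < 1"
  shows "deriv f z \<noteq> 0"
  using holomorphic_injective_imp_regular[OF assms(1) _ assms(2), of z] assms(3) by auto

lemma univalent_normalised:
  assumes hol: "f holomorphic_on ball 0 1" and inj: "inj_on f (ball 0 1)"
  shows "schlicht (\<lambda>z. (f z - f 0) / deriv f 0)"
proof -
  have n: "deriv f 0 \<noteq> 0" using univalent_deriv_nonzero[OF assms, of 0] by simp
  have "(f has_field_derivative deriv f 0) (at 0)"
    using holomorphic_derivI[OF hol, of 0] by simp
  then have "((\<lambda>z. (f z - f 0) / deriv f 0) has_field_derivative 1) (at 0)"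
    using n by (auto intro!: derivative_eq_intros)
  then have "deriv (\<lambda>z. (f z - f 0) / deriv f 0) 0 = 1" by (rule DERIV_imp_deriv)
  moreover have "inj_on (\<lambda>z. (f z - f 0) / deriv f 0) (ball 0 1)"
    using n inj by (auto simp: inj_on_def)
  ultimately show ?thesis unfolding schlicht_def using n
    by (auto intro!: holomorphic_intros hol)
qed

lemma univalent_second_deriv_le:
  assumes hol: "f holomorphic_on ball 0 1" and inj: "inj_on f (ball 0 1)"
  shows "cmod (deriv (deriv f) 0) \<le> 4 * cmod (deriv f 0)"
proof -
  define g where "g = (\<lambda>z. (f z - f 0) / deriv f 0)"
  have n: "deriv f 0 \<noteq> 0" using univalent_deriv_nonzero[OF assms, of 0] by simp
  have g: "schlicht g" unfolding g_def by (rule univalent_normalised[OF assms])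
  have G: "g has_fps_expansion fps_const (1 / deriv f 0) * (fps_expansion f 0 - fps_const (f 0))"
  proof -
    have "(\<lambda>z. (1 / deriv f 0) * (f z - f 0)) has_fps_expansion
        fps_const (1 / deriv f 0) * (fps_expansion f 0 - fps_const (f 0))"
      by (intro fps_expansion_intros holomorphic_has_fps_expansion hol)
    then show ?thesis by (simp add: g_def)
  qed
  have "cmod (fps_nth (fps_expansion f 0) 2 / deriv f 0) \<le> 2"
    using schlicht_second_coeff_le[OF g G] by (simp add: eval_nat_numeral)
  then show ?thesis
    using fps_expansion_nth_low(3)[OF holomorphic_has_fps_expansion[OF hol]] n
    by (simp add: norm_divide field_simps)
qed

text \<open>If \<open>w\<close> is omitted, \<open>w f / (w - f)\<close> is schlicht again with
  second coefficient \<open>fps_nth F 2 + 1 / w\<close>, and Bieberbach's inequality for it bounds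
  \<open>1 / w\<close>. Keeping \<open>cmod (fps_nth F 2)\<close> instead of replacing it by 2
  refines Koebe's quarter theorem.\<close>

lemma schlicht_omitted_value:
  assumes "schlicht f" and F: "f has_fps_expansion F" and w: "w \<notin> f ` ball 0 1"
  shows "1 \<le> cmod w * (2 + cmod (fps_nth F 2))"
proof -
  have hol: "f holomorphic_on ball 0 1" and inj: "inj_on f (ball 0 1)" and f0: "f 0 = 0" "deriv f 0 = 1"
    using assms(1) by (auto simp: schlicht_def)
  have w0: "w \<noteq> 0" using w f0 by (metis image_eqI centre_in_ball zero_less_one)
  have ne: "w - f z \<noteq> 0" if "cmod z < 1" for z using w that by auto
  define g where "g = (\<lambda>z. w * f z / (w - f z))"
  have holg: "g holomorphic_on ball 0 1"
    unfolding g_def using ne by (intro holomorphic_intros hol) auto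
  have "inj_on g (ball 0 1)"
  proof (rule inj_onI)
    fix x y assume xy: "x \<in> ball 0 1" "y \<in> ball 0 1" "g x = g y"
    then have "w * f x * (w - f y) = w * f y * (w - f x)"
      using ne[of x] ne[of y] by (simp add: g_def field_simps)
    then have "w * w * (f x - f y) = 0" by (simp add: algebra_simps)
    then show "x = y" using w0 inj xy by (auto dest: inj_onD)
  qed
  moreover have "(f has_field_derivative 1) (at 0)"
    using holomorphic_derivI[OF hol, of 0] f0 by simp
  then have "(g has_field_derivative 1) (at 0)" unfolding g_def
    using w0 f0 by (auto intro!: derivative_eq_intros simp: field_simps)
  then have dg: "deriv g 0 = 1" by (rule DERIV_imp_deriv)
  ultimately have sg: "schlicht g" using holg f0 by (simp add: schlicht_def g_def)
  define G where "G = fps_expansion g 0"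
  have G: "g has_fps_expansion G" unfolding G_def by (rule holomorphic_has_fps_expansion[OF holg])
  have "G * (fps_const w - F) = fps_const w * F"
  proof (rule fps_expansion_mult_eq[OF G])
    show "(\<lambda>z. w - f z) has_fps_expansion fps_const w - F" by (intro fps_expansion_intros F)
    show "(\<lambda>z. w * f z) has_fps_expansion fps_const w * F" by (intro fps_expansion_intros F)
  qed (use ne in \<open>auto simp: g_def\<close>)
  then have "fps_nth (G * (fps_const w - F)) 2 = w * fps_nth F 2" by simp
  then have "fps_nth G 2 * w = 1 + w * fps_nth F 2"
    using fps_expansion_nth_low[OF F] fps_expansion_nth_low[OF G] f0 dg
    by (simp add: fps_mult_nth eval_nat_numeral g_def algebra_simps)
  then have "1 = (fps_nth G 2 - fps_nth F 2) * w" by (simp add: algebra_simps)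
  then have "1 = cmod (fps_nth G 2 - fps_nth F 2) * cmod w" by (metis norm_mult norm_one)
  also have "\<dots> \<le> (2 + cmod (fps_nth F 2)) * cmod w"
    using schlicht_second_coeff_le[OF sg G]
    by (intro mult_right_mono order.trans[OF norm_triangle_ineq4]) auto
  finally show ?thesis by (simp add: mult.commute)
qed

text \<open>This is \<open>univalent_second_deriv_le\<close> for \<open>f\<close> composed with the
  disc automorphism \<open>m\<close> that takes 0 to \<open>a\<close>. Real \<open>a\<close> is
  enough because the growth theorem first rotates its point onto the real axis.\<close>

lemma univalent_koebe_transform:
  assumes hol: "f holomorphic_on ball 0 1" and inj: "inj_on f (ball 0 1)" and a: "0 \<le> a" "a < 1"
  shows "cmod (deriv (deriv f) (of_real a) * (1 - of_real a ^ 2) - 2 * of_real a * deriv f (of_real a))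
     \<le> 4 * cmod (deriv f (of_real a))"
proof -
  define A where "A = complex_of_real a"
  have A: "cmod A < 1" "cnj A = A" using a by (auto simp: A_def)
  define m where "m = (\<lambda>z. (z + A) / (1 + A * z))"
  define g where "g = (\<lambda>z. f (m z))"
  have den: "1 + A * z \<noteq> 0" if "cmod z < 1" for z
  proof
    assume "1 + A * z = 0"
    then have "A * z = - 1" by (simp add: add_eq_0_iff)
    then have "cmod A * cmod z = 1" by (metis norm_mult norm_minus_cancel norm_one)
    then show False using A that mult_le_one[of "cmod A" "cmod z"]
      by (smt (verit) mult_left_le norm_ge_zero)
  qed
  have m1: "cmod (m z) < 1" if z: "cmod z < 1" for z
  proof -
    have "(cmod (1 + A * z))\<^sup>2 - (cmod (z + A))\<^sup>2 = (1 - a\<^sup>2) * (1 - (cmod z)\<^sup>2)"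
      unfolding cmod_power2 A_def by (simp add: power2_eq_square algebra_simps)
    also have "\<dots> > 0" using a z by (intro mult_pos_pos) (auto simp: power_less_one_iff abs_square_less_1)
    finally have "cmod (z + A) < cmod (1 + A * z)" by (simp add: power2_less_imp_less)
    then show ?thesis using den[OF z] by (simp add: m_def norm_divide)
  qed
  have holm: "m holomorphic_on ball 0 1" unfolding m_def using den by (intro holomorphic_intros) auto
  have holg: "g holomorphic_on ball 0 1"
    unfolding g_def by (rule holomorphic_on_compose_gen[OF holm hol, unfolded o_def]) (use m1 in auto)
  have A2: "1 - A\<^sup>2 \<noteq> 0"
  proof -
    have "a\<^sup>2 < 1" using a by (simp add: abs_square_less_1)
    then have "1 - a\<^sup>2 \<noteq> 0" by simp
    then have "complex_of_real (1 - a\<^sup>2) \<noteq> 0" by (metis of_real_eq_0_iff)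
    then show ?thesis by (simp add: A_def)
  qed
  have injg: "inj_on g (ball 0 1)"
  proof (rule inj_onI)
    fix x y assume xy: "x \<in> ball 0 1" "y \<in> ball 0 1" "g x = g y"
    then have "m x = m y" using inj_onD[OF inj] m1 by (auto simp: g_def)
    then have "(x + A) * (1 + A * y) = (y + A) * (1 + A * x)"
      using den[of x] den[of y] xy by (simp add: m_def field_simps)
    then have "(1 - A\<^sup>2) * (x - y) = 0" by (simp add: algebra_simps power2_eq_square)
    then show "x = y" using A2 by simp
  qed
  have dm: "(m has_field_derivative (1 - A\<^sup>2) / (1 + A * z)\<^sup>2) (at z)" if "cmod z < 1" for z
    unfolding m_def using den[OF that]
    by (auto intro!: derivative_eq_intros simp: power2_eq_square field_simps)
  have df: "(f has_field_derivative deriv f (m z)) (at (m z))" if "cmod z < 1" for z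
    using holomorphic_derivI[OF hol, of "m z"] m1[OF that] by simp
  have dg: "deriv g z = deriv f (m z) * ((1 - A\<^sup>2) / (1 + A * z)\<^sup>2)" if "cmod z < 1" for z
    unfolding g_def by (rule DERIV_imp_deriv, rule DERIV_chain2[OF df[OF that] dm[OF that]])
  have "(deriv f has_field_derivative deriv (deriv f) (m 0)) (at (m 0))"
    by (rule holomorphic_derivI[OF holomorphic_deriv[OF hol]]) (use m1[of 0] in auto)
  then have "((\<lambda>z. deriv f (m z)) has_field_derivative deriv (deriv f) (m 0) * ((1 - A\<^sup>2) / (1 + A * 0)\<^sup>2)) (at 0)"
    by (rule DERIV_chain2[OF _ dm]) simp
  then have "((\<lambda>z. deriv f (m z) * ((1 - A\<^sup>2) / (1 + A * z)\<^sup>2)) has_field_derivative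
      deriv (deriv f) A * (1 - A\<^sup>2)\<^sup>2 - 2 * A * (1 - A\<^sup>2) * deriv f A) (at 0)"
    by (auto intro!: derivative_eq_intros simp: m_def power2_eq_square algebra_simps)
  then have "(deriv g has_field_derivative deriv (deriv f) A * (1 - A\<^sup>2)\<^sup>2 - 2 * A * (1 - A\<^sup>2) * deriv f A) (at 0)"
    by (rule DERIV_cong_ev[THEN iffD1, rotated -1])
       (use dg in \<open>auto intro!: eventually_mono[OF eventually_nhds_in_open[of "ball 0 1"]]\<close>)
  then have "deriv (deriv g) 0 = (1 - A\<^sup>2) * (deriv (deriv f) A * (1 - A\<^sup>2) - 2 * A * deriv f A)"
    by (subst DERIV_imp_deriv) (auto simp: power2_eq_square algebra_simps)
  moreover have "deriv g 0 = (1 - A\<^sup>2) * deriv f A" using dg[of 0] by (simp add: m_def)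
  ultimately have "cmod (1 - A\<^sup>2) * cmod (deriv (deriv f) A * (1 - A\<^sup>2) - 2 * A * deriv f A)
      \<le> cmod (1 - A\<^sup>2) * (4 * cmod (deriv f A))"
    using univalent_second_deriv_le[OF holg injg] by (simp add: norm_mult mult_ac)
  then show ?thesis using A2 by (simp add: A_def)
qed

text \<open>The weight in \<open>W\<close> is the inverse square of the derivative
  \<open>(1 + x) / (1 - x) ^ 3\<close> of the Koebe function, so the claim amounts to
  \<open>W x \<le> W 0\<close>. The Koebe transform and Cauchy-Schwarz give the sign of the
  derivative of \<open>W\<close>; working with \<open>V t \<bullet> V t\<close> avoids
  differentiating a modulus or a logarithm.\<close>

lemma univalent_distortion:
  assumes hol: "f holomorphic_on ball 0 1" and inj: "inj_on f (ball 0 1)" and x: "0 \<le> x" "x < 1"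
  shows "cmod (deriv f (of_real x)) \<le> cmod (deriv f 0) * ((1 + x) / (1 - x) ^ 3)"
proof -
  define V where "V = (\<lambda>x::real. deriv f (of_real x))"
  define V' where "V' = (\<lambda>x::real. deriv (deriv f) (of_real x))"
  define W where "W = (\<lambda>x. (V x \<bullet> V x) * ((1 - x) ^ 6 / (1 + x)\<^sup>2))"
  have dV: "(V has_vector_derivative V' t) (at t)" if "0 \<le> t" "t < 1" for t
    unfolding V_def V'_def
    by (rule has_vector_derivative_real_field,
        rule holomorphic_derivI[OF holomorphic_deriv[OF hol]]) (use that in auto)
  have key: "(1 - t\<^sup>2) * (V t \<bullet> V' t) \<le> (4 + 2 * t) * (V t \<bullet> V t)" if t: "0 \<le> t" "t < 1" for t
  proof -
    have "V t \<bullet> (V' t * (1 - of_real t ^ 2) - 2 * of_real t * V t)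
        \<le> cmod (V t) * cmod (V' t * (1 - of_real t ^ 2) - 2 * of_real t * V t)"
      by (rule norm_cauchy_schwarz)
    also have "\<dots> \<le> cmod (V t) * (4 * cmod (V t))"
      using univalent_koebe_transform[OF hol inj t] by (intro mult_left_mono) (auto simp: V_def V'_def)
    also have "\<dots> = 4 * (V t \<bullet> V t)" by (simp add: dot_square_norm power2_eq_square)
    also have "V' t * (1 - of_real t ^ 2) - 2 * of_real t * V t = (1 - t\<^sup>2) *\<^sub>R V' t - (2 * t) *\<^sub>R V t"
      by (simp add: scaleR_conv_of_real)
    finally show ?thesis by (simp add: inner_diff_right algebra_simps)
  qed
  have "W x \<le> W 0"
  proof (rule DERIV_nonpos_imp_nonincreasing[OF x(1)])
    fix t assume t: "0 \<le> t" "t \<le> x"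
    then have t1: "t < 1" using x by simp
    define D where "D = 2 * (1 - t) ^ 5 / (1 + t) ^ 3 *
       ((1 - t\<^sup>2) * (V t \<bullet> V' t) - (4 + 2 * t) * (V t \<bullet> V t))"
    have dVV: "((\<lambda>x. V x \<bullet> V x) has_field_derivative 2 * (V t \<bullet> V' t)) (at t)"
      using has_derivative_inner[OF dV[OF t(1) t1, unfolded has_vector_derivative_def]
          dV[OF t(1) t1, unfolded has_vector_derivative_def]]
      by (auto simp: has_field_derivative_def inner_commute algebra_simps elim!: has_derivative_eq_rhs)
    have dw: "((\<lambda>x. (1 - x) ^ 6 / (1 + x)\<^sup>2) has_field_derivative
         - ((1 - t) ^ 5 * (8 + 4 * t)) / (1 + t) ^ 3) (at t)"
      using t by (auto intro!: derivative_eq_intros simp: divide_simps) (simp add: eval_nat_numeral algebra_simps)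
    have "(W has_field_derivative 2 * (V t \<bullet> V' t) * ((1 - t) ^ 6 / (1 + t)\<^sup>2) +
         (- ((1 - t) ^ 5 * (8 + 4 * t)) / (1 + t) ^ 3) * (V t \<bullet> V t)) (at t)"
      unfolding W_def by (rule DERIV_mult'[OF dVV dw, THEN DERIV_cong]) simp
    moreover have "2 * (V t \<bullet> V' t) * ((1 - t) ^ 6 / (1 + t)\<^sup>2) +
         (- ((1 - t) ^ 5 * (8 + 4 * t)) / (1 + t) ^ 3) * (V t \<bullet> V t) = D"
    proof -
      define A where "A = (1 - t) ^ 5 / (1 + t) ^ 3"
      have "(1 - t) ^ 6 / (1 + t)\<^sup>2 = A * (1 - t\<^sup>2)"
        using t by (simp add: A_def divide_simps) (simp add: eval_nat_numeral algebra_simps)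
      moreover have "- ((1 - t) ^ 5 * (8 + 4 * t)) / (1 + t) ^ 3 = - A * (8 + 4 * t)"
        by (simp add: A_def)
      moreover have "D = 2 * A * ((1 - t\<^sup>2) * (V t \<bullet> V' t) - (4 + 2 * t) * (V t \<bullet> V t))"
        by (simp add: D_def A_def)
      ultimately show ?thesis by (simp only:) (simp add: algebra_simps)
    qed
    moreover have "D \<le> 0" unfolding D_def
      using key[OF t(1) t1] t t1 by (intro mult_nonneg_nonpos) auto
    ultimately show "\<exists>y. (W has_field_derivative y) (at t) \<and> y \<le> 0" by metis
  qed
  then have "(cmod (V x))\<^sup>2 * ((1 - x) ^ 6 / (1 + x)\<^sup>2) \<le> (cmod (V 0))\<^sup>2"
    by (simp add: W_def dot_square_norm)
  then have "(cmod (V x))\<^sup>2 \<le> (cmod (V 0))\<^sup>2 * ((1 + x)\<^sup>2 / (1 - x) ^ 6)"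
    using x by (simp add: field_simps)
  also have "\<dots> = (cmod (V 0) * ((1 + x) / (1 - x) ^ 3))\<^sup>2"
    by (simp add: power_mult_distrib power_divide flip: power_mult)
  finally have "cmod (V x) \<le> cmod (V 0) * ((1 + x) / (1 - x) ^ 3)"
    by (rule power2_le_imp_le) (use x in auto)
  then show ?thesis by (simp add: V_def)
qed

lemma schlicht_rotation:
  assumes f: "schlicht f" and u: "cmod u = 1"
  shows "schlicht (\<lambda>z. f (u * z) / u)"
proof -
  have hol: "f holomorphic_on ball 0 1" and inj: "inj_on f (ball 0 1)" and f0: "f 0 = 0" "deriv f 0 = 1"
    using f by (auto simp: schlicht_def)
  have u0: "u \<noteq> 0" using u by auto
  have im: "(\<lambda>z. u * z) ` ball 0 1 \<subseteq> ball 0 1" using u by (auto simp: norm_mult)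
  have "(\<lambda>z. f (u * z)) holomorphic_on ball 0 1"
    by (rule holomorphic_on_compose_gen[OF _ hol im, unfolded o_def]) (intro holomorphic_intros)
  moreover have "inj_on (\<lambda>z. f (u * z) / u) (ball 0 1)"
    using inj u0 im by (auto simp: inj_on_def) (metis image_subset_iff mem_ball_0 mult_cancel_left)
  moreover have "(f has_field_derivative 1) (at (u * 0))"
    using holomorphic_derivI[OF hol, of 0] f0 by simp
  then have "((\<lambda>z. f (u * z) / u) has_field_derivative 1) (at 0)"
    using u0 by (auto intro!: derivative_eq_intros DERIV_chain2)
  then have "deriv (\<lambda>z. f (u * z) / u) 0 = 1" by (rule DERIV_imp_deriv)
  ultimately show ?thesis unfolding schlicht_def using u0 f0 by (auto intro!: holomorphic_intros)
qed

text \<open>Distortion integrated along a radius: \<open>t / (1 - t)\<^sup>2\<close> has derivative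
  \<open>(1 + t) / (1 - t) ^ 3\<close>. The rotation by \<open>u\<close> moves \<open>z\<close> to
  the positive axis.\<close>

lemma schlicht_growth:
  assumes f: "schlicht f" and z: "cmod z < 1"
  shows "cmod (f z) \<le> cmod z / (1 - cmod z)\<^sup>2"
proof (cases "z = 0")
  case False
  define x where "x = cmod z"
  have x: "0 < x" "x < 1" using False z by (auto simp: x_def)
  define u where "u = z / of_real x"
  have u: "cmod u = 1" "u * of_real x = z" using x by (auto simp: u_def x_def norm_divide)
  define g where "g = (\<lambda>z. f (u * z) / u)"
  have sg: "schlicht g" unfolding g_def by (rule schlicht_rotation[OF f u(1)])
  have hol: "g holomorphic_on ball 0 1" and inj: "inj_on g (ball 0 1)" and g0: "g 0 = 0" "deriv g 0 = 1"
    using sg by (auto simp: schlicht_def)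
  have "norm (g (of_real x) - g (of_real 0)) \<le> x / (1 - x)\<^sup>2 - 0 / (1 - 0)\<^sup>2"
  proof (rule differentiable_bound_general[OF x(1), where f = "\<lambda>t. g (of_real t)" and \<phi> = "\<lambda>t. t / (1 - t)\<^sup>2"])
    show "continuous_on {0..x} (\<lambda>t. g (of_real t))"
      by (rule continuous_on_compose2[OF holomorphic_on_imp_continuous_on[OF hol]])
         (use x in \<open>auto intro!: continuous_intros\<close>)
    show "continuous_on {0..x} (\<lambda>t. t / (1 - t)\<^sup>2)"
      using x by (intro continuous_intros) auto
    fix t assume t: "0 < t" "t < x"
    show "((\<lambda>t. g (of_real t)) has_vector_derivative deriv g (of_real t)) (at t)"
      by (rule has_vector_derivative_real_field, rule holomorphic_derivI[OF hol]) (use t x in auto)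
    have "((\<lambda>t. t / (1 - t)\<^sup>2) has_field_derivative ((1 + t) / (1 - t) ^ 3)) (at t)"
      using t x by (auto intro!: derivative_eq_intros simp: divide_simps) (simp add: eval_nat_numeral algebra_simps)
    then show "((\<lambda>t. t / (1 - t)\<^sup>2) has_vector_derivative ((1 + t) / (1 - t) ^ 3)) (at t)"
      by (simp add: has_real_derivative_iff_has_vector_derivative)
    show "norm (deriv g (of_real t)) \<le> (1 + t) / (1 - t) ^ 3"
      using univalent_distortion[OF hol inj, of t] t x g0 by simp
  qed
  moreover have "cmod (g (of_real x)) = cmod (f z)" using u by (simp add: g_def norm_divide)
  ultimately show ?thesis using g0 by (simp add: x_def)
qed (use f in \<open>simp add: schlicht_def\<close>)

section \<open>Bohr inequalities\<close>

text \<open>Parseval on both sides. Only the circle \<open>cmod z = r\<close> enters, so a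
  comparison available at a single radius suffices.\<close>

lemma power_series_l2_mono:
  assumes f: "f holomorphic_on ball 0 1" "f has_fps_expansion F"
    and g: "g holomorphic_on ball 0 1" "g has_fps_expansion G"
    and le: "\<And>z. cmod z = r \<Longrightarrow> cmod (f z) \<le> cmod (g z)" and r: "0 \<le> r" "r < 1"
  shows "(\<Sum>n. (cmod (fps_nth F n))\<^sup>2 * r ^ (2 * n)) \<le> (\<Sum>n. (cmod (fps_nth G n))\<^sup>2 * r ^ (2 * n))"
proof -
  have "integral {-pi..pi} (\<lambda>t. (cmod (f (of_real r * cis t)))\<^sup>2) / (2 * pi)
      \<le> integral {-pi..pi} (\<lambda>t. (cmod (g (of_real r * cis t)))\<^sup>2) / (2 * pi)"
    by (intro divide_right_mono integral_le parseval_circle(2)[OF f r] parseval_circle(2)[OF g r] power_mono le)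
       (use r in \<open>auto simp: norm_mult\<close>)
  then show ?thesis
    using parseval_circle(1)[OF f r] parseval_circle(1)[OF g r] by (simp add: sums_iff)
qed

text \<open>The \<open>L\<^sup>2\<close> norms of \<open>f p\<close> and \<open>B p\<close> are compared for the test polynomials \<open>p = 1 + l z\<^sup>n\<close>.\<close>

lemma bounded_function_coeff_le:
  assumes hol: "f holomorphic_on ball 0 1" and F: "f has_fps_expansion F"
    and B: "\<And>z. cmod z < 1 \<Longrightarrow> cmod (f z) \<le> B" and n: "n > 0"
  shows "B * cmod (fps_nth F n) \<le> B\<^sup>2 - (cmod (fps_nth F 0))\<^sup>2"
proof -
  define a where "a = cmod (fps_nth F 0)"
  define x where "x = cmod (fps_nth F n)"
  define d where "d = B\<^sup>2 - a\<^sup>2"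
  have "0 \<le> cmod (f 0)" by simp
  also have "\<dots> \<le> B" by (rule B) simp
  finally have B0: "B \<ge> 0" .
  have a0: "a \<ge> 0" "x \<ge> 0" by (simp_all add: a_def x_def)
  have test: "a\<^sup>2 + (cmod (fps_nth F n + l * fps_nth F 0))\<^sup>2 \<le> B\<^sup>2 * (1 + (cmod l)\<^sup>2)" for l
  proof -
    define y where "y = (cmod (fps_nth F n + l * fps_nth F 0))\<^sup>2"
    have ineq: "a\<^sup>2 + y * r ^ (2 * n) \<le> B\<^sup>2 * (1 + (cmod l)\<^sup>2 * r ^ (2 * n))" if r: "0 < r" "r < 1" for r
    proof -
      define p where "p = (\<lambda>z::complex. 1 + l * z ^ n)"
      define P where "P = 1 + fps_const l * fps_X ^ n"
      have p: "p holomorphic_on ball 0 1" "p has_fps_expansion P"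
        unfolding p_def P_def
        by (intro holomorphic_intros)
           (rule has_fps_expansion_add has_fps_expansion_1 has_fps_expansion_cmult_left
             has_fps_expansion_fps_X_power)+
      have Pn: "fps_nth P m = (if m = 0 then 1 else if m = n then l else 0)" for m
        using n by (auto simp: P_def)
      have 1: "(\<lambda>z. f z * p z) holomorphic_on ball 0 1" "(\<lambda>z. f z * p z) has_fps_expansion F * P"
        by (rule holomorphic_on_mult[OF hol p(1)], rule has_fps_expansion_mult[OF F p(2)])
      have 2: "(\<lambda>z. of_real B * p z) holomorphic_on ball 0 1"
          "(\<lambda>z. of_real B * p z) has_fps_expansion fps_const (of_real B) * P"
        by (rule holomorphic_on_mult[OF holomorphic_on_const p(1)], rule has_fps_expansion_cmult_left[OF p(2)])
      have FP: "fps_nth (F * P) 0 = fps_nth F 0" "fps_nth (F * P) n = fps_nth F n + l * fps_nth F 0"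
      proof -
        have "F * P = F + fps_const l * (fps_X ^ n * F)" by (simp add: P_def algebra_simps)
        then show "fps_nth (F * P) 0 = fps_nth F 0" "fps_nth (F * P) n = fps_nth F n + l * fps_nth F 0"
          using n by (simp_all add: fps_X_power_mult_nth)
      qed
      \<comment> \<open>Of \<open>f * p\<close> only the coefficients 0 and \<open>n\<close> are
        kept; \<open>B * p\<close> on the right has no others.\<close>
      have "(\<Sum>m\<in>{0, n}. (cmod (fps_nth (F * P) m))\<^sup>2 * r ^ (2 * m)) \<le> (\<Sum>m. (cmod (fps_nth (F * P) m))\<^sup>2 * r ^ (2 * m))"
        using parseval_circle(1)[OF 1, of r] r by (intro sum_le_suminf) (auto simp: sums_iff)
      also have "\<dots> \<le> (\<Sum>m. (cmod (fps_nth (fps_const (of_real B) * P) m))\<^sup>2 * r ^ (2 * m))"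
        using r B0 B by (intro power_series_l2_mono[OF 1 2]) (auto simp: norm_mult intro!: mult_right_mono)
      also have "\<dots> = (\<Sum>m\<in>{0, n}. (cmod (fps_nth (fps_const (of_real B) * P) m))\<^sup>2 * r ^ (2 * m))"
        by (rule suminf_finite) (auto simp: Pn)
      finally show ?thesis
        using n FP by (simp add: Pn norm_mult power_mult_distrib a_def y_def algebra_simps)
    qed
    have "a\<^sup>2 + y * 1 ^ (2 * n) \<le> B\<^sup>2 * (1 + (cmod l)\<^sup>2 * 1 ^ (2 * n))"
    proof (rule tendsto_le[OF trivial_limit_at_left_real])
      show "((\<lambda>r. a\<^sup>2 + y * r ^ (2 * n)) \<longlongrightarrow> a\<^sup>2 + y * 1 ^ (2 * n)) (at_left (1::real))"
        by (intro tendsto_intros)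
      show "((\<lambda>r. B\<^sup>2 * (1 + (cmod l)\<^sup>2 * r ^ (2 * n))) \<longlongrightarrow> B\<^sup>2 * (1 + (cmod l)\<^sup>2 * 1 ^ (2 * n))) (at_left (1::real))"
        by (intro tendsto_intros)
      have "eventually (\<lambda>r. 0 < r \<and> r < 1) (at_left (1::real))"
        unfolding eventually_at_left_field by (rule exI[of _ 0]) auto
      then show "eventually (\<lambda>r. a\<^sup>2 + y * r ^ (2 * n) \<le> B\<^sup>2 * (1 + (cmod l)\<^sup>2 * r ^ (2 * n))) (at_left (1::real))"
        by eventually_elim (use ineq in auto)
    qed
    then show ?thesis by (simp add: y_def)
  qed
  have key: "(x + L * a)\<^sup>2 \<le> d + B\<^sup>2 * L\<^sup>2" if "L \<ge> 0" for L
  proof -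
    \<comment> \<open>The phase of \<open>l\<close> aligns \<open>l * fps_nth F 0\<close> with
      \<open>fps_nth F n\<close>, so that their moduli add. If one of the two coefficients is 0, any
      phase does.\<close>
    define l where "l = (if fps_nth F 0 = 0 \<or> fps_nth F n = 0 then of_real L
       else of_real L * sgn (fps_nth F n) / sgn (fps_nth F 0))"
    have "cmod l = L" using that by (auto simp: l_def norm_mult norm_divide norm_sgn)
    moreover have "cmod (fps_nth F n + l * fps_nth F 0) = x + L * a"
    proof (cases "fps_nth F 0 = 0 \<or> fps_nth F n = 0")
      case False
      then have "fps_nth F n + l * fps_nth F 0 = sgn (fps_nth F n) * of_real (x + L * a)"
        by (simp add: l_def x_def a_def sgn_eq field_simps)
      moreover have "x + L * a \<ge> 0" using that a0 by simp
      ultimately show ?thesis using False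
        by (simp add: norm_mult norm_sgn del: of_real_add of_real_mult)
    qed (use that in \<open>auto simp: l_def x_def a_def norm_mult\<close>)
    ultimately show ?thesis using test[of l] by (simp add: d_def algebra_simps)
  qed
  show ?thesis
  proof (cases "d > 0")
    case True
    \<comment> \<open>This \<open>L\<close> maximises the quadratic
      \<open>(x + L * a)\<^sup>2 - B\<^sup>2 * L\<^sup>2\<close>; the inequality then becomes
      \<open>(B * x)\<^sup>2 \<le> d\<^sup>2\<close>.\<close>
    define L where "L = a * x / d"
    have Ld: "L * d = a * x" "L \<ge> 0" using True a0 by (simp_all add: L_def)
    have "x\<^sup>2 + 2 * (L * (a * x)) + L\<^sup>2 * a\<^sup>2 \<le> d + B\<^sup>2 * L\<^sup>2"
      using key[OF Ld(2)] by (simp add: power2_sum power_mult_distrib algebra_simps)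
    then have "x\<^sup>2 + 2 * (L * (L * d)) \<le> d + L\<^sup>2 * d"
      unfolding Ld(1) by (simp add: d_def algebra_simps)
    then have "x\<^sup>2 + L * (L * d) \<le> d" by (simp add: power2_eq_square)
    then have "(x\<^sup>2 + L * (a * x)) * d \<le> d * d"
      unfolding Ld(1) using True by (intro mult_right_mono) auto
    then have "x\<^sup>2 * d + (L * d) * (a * x) \<le> d\<^sup>2" by (simp add: algebra_simps power2_eq_square)
    moreover have "(B * x)\<^sup>2 = x\<^sup>2 * d + (a * x) * (a * x)"
      by (simp add: d_def power2_eq_square algebra_simps)
    ultimately have "(B * x)\<^sup>2 \<le> d\<^sup>2" by (simp only: Ld(1))
    then have "B * x \<le> d" by (rule power2_le_imp_le) (use True in simp)
    then show ?thesis by (simp add: x_def a_def d_def)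
  next
    case False
    have "(x + 0 * a)\<^sup>2 \<le> d + B\<^sup>2 * 0\<^sup>2" by (rule key) simp
    then have "x\<^sup>2 \<le> d" by simp
    moreover have "0 \<le> x\<^sup>2" by simp
    ultimately have "x\<^sup>2 = 0" "d = 0" using False by linarith+
    then have "x = 0" "d = 0" by simp_all
    then show ?thesis by (simp add: x_def a_def d_def)
  qed
qed

text \<open>For \<open>r \<le> 1 / 3\<close> the powers \<open>r ^ n\<close> with
  \<open>n > 0\<close> sum to at most 1/2. With \<open>bounded_function_coeff_le\<close>, the claim
  multiplied by \<open>B\<close> reduces to \<open>B * a + (B^2 - a^2) / 2 <= B^2\<close>, that is,
  to \<open>(B - a)^2 >= 0\<close>. Stated for partial sums, it keeps the rearrangements in its
  applications finite.\<close>

lemma bohr_inequality: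
  assumes hol: "f holomorphic_on ball 0 1" and F: "f has_fps_expansion F"
    and B: "\<And>z. cmod z < 1 \<Longrightarrow> cmod (f z) \<le> B" and r: "0 \<le> r" "r \<le> 1 / 3"
  shows "(\<Sum>n<N. cmod (fps_nth F n) * r ^ n) \<le> B"
proof -
  define a where "a = cmod (fps_nth F 0)"
  have aB: "a \<le> B" using B[of 0] fps_expansion_nth_low(1)[OF F] by (simp add: a_def)
  have a0: "a \<ge> 0" by (simp add: a_def)
  show ?thesis
  proof (cases "B = 0")
    case True
    then have "f z = 0" if "cmod z < 1" for z using B[OF that] by simp
    then have "(deriv ^^ n) f 0 = (deriv ^^ n) (\<lambda>_. 0) 0" for n
      by (intro higher_deriv_transform_within_open[of _ "ball 0 1"]) (auto intro: hol)
    then have "fps_nth F n = 0" for n by (simp add: fps_nth_fps_expansion[OF F])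
    then show ?thesis using True by simp
  next
    case False
    with aB a0 have B0: "B > 0" by simp
    have geo: "(\<Sum>n<M. r ^ Suc n) \<le> 1 / 2" for M
    proof -
      have "(\<Sum>n<M. r ^ Suc n) \<le> (\<Sum>n<M. (1 / 3) ^ Suc n)" using r by (intro sum_mono power_mono) auto
      also have "\<dots> = (1 - (1 / 3) ^ M) / 2"
        by (induction M) (simp_all add: diff_divide_distrib)
      also have "\<dots> \<le> 1 / 2" by simp
      finally show ?thesis .
    qed
    have "(\<Sum>n<N. B * (cmod (fps_nth F n) * r ^ n)) \<le> (\<Sum>n<Suc N. B * (cmod (fps_nth F n) * r ^ n))"
      using r B0 by (intro sum_mono2) auto
    also have "\<dots> = B * a + (\<Sum>n<N. (B * cmod (fps_nth F (Suc n))) * r ^ Suc n)"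
      unfolding sum.lessThan_Suc_shift by (simp add: a_def mult.assoc)
    also have "\<dots> \<le> B * a + (\<Sum>n<N. (B\<^sup>2 - a\<^sup>2) * r ^ Suc n)"
      using bounded_function_coeff_le[OF hol F B] r
      by (intro add_left_mono sum_mono mult_right_mono) (auto simp: a_def)
    also have "\<dots> = B * a + (B\<^sup>2 - a\<^sup>2) * (\<Sum>n<N. r ^ Suc n)" by (simp add: sum_distrib_left)
    also have "\<dots> \<le> B * a + (B\<^sup>2 - a\<^sup>2) * (1 / 2)"
      using aB a0 by (intro add_left_mono mult_left_mono geo) (auto intro: power_mono)
    also have "\<dots> \<le> B * B" using zero_le_power2[of "B - a"] by (simp add: power2_eq_square algebra_simps)
    finally have "B * (\<Sum>n<N. cmod (fps_nth F n) * r ^ n) \<le> B * B" by (simp add: sum_distrib_left)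
    then show ?thesis using B0 by simp
  qed
qed

text \<open>Write \<open>\<omega> z = z * \<phi> z\<close>. The coefficient \<open>n\<close> of
  \<open>h\<close> is the sum over \<open>k\<close> of \<open>P_k\<close> times the coefficient
  \<open>n - k\<close> of \<open>\<phi> ^ k\<close>. After exchanging sums, each
  \<open>|P_k| r ^ k\<close> is multiplied by a partial majorant sum of \<open>\<phi> ^ k\<close>,
  at most 1 by Bohr's inequality.\<close>

lemma subordinate_coeff_sum_le:
  assumes psi: "\<psi> holomorphic_on ball 0 1" "\<psi> has_fps_expansion P"
    and om: "\<omega> holomorphic_on ball 0 1" "\<omega> ` ball 0 1 \<subseteq> ball 0 1" "\<omega> 0 = 0"
    and h: "h has_fps_expansion H" "\<And>z. cmod z < 1 \<Longrightarrow> h z = \<psi> (\<omega> z)"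
    and r: "0 \<le> r" "r \<le> 1 / 3"
  shows "(\<Sum>n<N. cmod (fps_nth H (Suc n)) * r ^ Suc n) \<le> (\<Sum>n<N. cmod (fps_nth P (Suc n)) * r ^ Suc n)"
proof -
  have om1: "cmod (\<omega> z) < 1" if "cmod z < 1" for z
    using om(2) that by (simp add: image_subset_iff)
  obtain \<phi> where \<phi>: "\<phi> holomorphic_on ball 0 1" "\<And>z. cmod z < 1 \<Longrightarrow> \<omega> z = z * \<phi> z" "deriv \<omega> 0 = \<phi> 0"
    using Schwarz3[OF om(1,3)] by blast
  have \<phi>1: "cmod (\<phi> z) \<le> 1" if z: "cmod z < 1" for z
  proof (cases "z = 0")
    case True
    then show ?thesis using Schwarz_Lemma(2)[OF om(1,3) om1 z] \<phi>(3) by simp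
  next
    case False
    then show ?thesis using Schwarz_Lemma(1)[OF om(1,3) om1 z] \<phi>(2)[OF z] by (simp add: norm_mult)
  qed
  define \<Phi> where "\<Phi> = fps_expansion \<phi> 0"
  have \<Phi>: "\<phi> has_fps_expansion \<Phi>" unfolding \<Phi>_def by (rule holomorphic_has_fps_expansion[OF \<phi>(1)])
  have W: "\<omega> has_fps_expansion fps_X * \<Phi>"
  proof -
    have "(\<lambda>z. z * \<phi> z) has_fps_expansion fps_X * \<Phi>" by (intro fps_expansion_intros \<Phi>)
    moreover have "eventually (\<lambda>z. z * \<phi> z = \<omega> z) (nhds 0)"
      by (rule eventually_mono[OF eventually_nhds_in_open[of "ball 0 1"]]) (use \<phi>(2) in auto)
    ultimately show ?thesis by (simp add: has_fps_expansion_cong)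
  qed
  have "(\<psi> \<circ> \<omega>) has_fps_expansion fps_compose P (fps_X * \<Phi>)"
    by (rule has_fps_expansion_compose[OF psi(2) W]) simp
  moreover have "eventually (\<lambda>z. (\<psi> \<circ> \<omega>) z = h z) (nhds 0)"
    by (rule eventually_mono[OF eventually_nhds_in_open[of "ball 0 1"]]) (use h(2) in auto)
  ultimately have "h has_fps_expansion fps_compose P (fps_X * \<Phi>)" by (simp add: has_fps_expansion_cong)
  then have "H = fps_compose P (fps_X * \<Phi>)" using h(1) fps_expansion_unique_complex by blast
  then have coeff: "fps_nth H n = (\<Sum>k\<le>n. fps_nth P k * fps_nth (\<Phi> ^ k) (n - k))" for n
    by (simp add: fps_compose_nth power_mult_distrib fps_X_power_mult_nth atMost_atLeast0)
  \<comment> \<open>Padding with zeros for \<open>n < k\<close> makes the index range a square, so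
    that the sums can be exchanged.\<close>
  have "(\<Sum>n<N. cmod (fps_nth H (Suc n)) * r ^ Suc n)
     \<le> (\<Sum>n<N. (\<Sum>k<N. if n < k then 0 else cmod (fps_nth P (Suc k)) * r ^ Suc k * (cmod (fps_nth (\<Phi> ^ Suc k) (n - k)) * r ^ (n - k))))"
  proof (rule sum_mono)
    fix n assume n: "n \<in> {..<N}"
    have "fps_nth H (Suc n) = (\<Sum>k<N. if n < k then 0 else fps_nth P (Suc k) * fps_nth (\<Phi> ^ Suc k) (n - k))"
    proof -
      have "fps_nth H (Suc n) = (\<Sum>k\<le>n. fps_nth P (Suc k) * fps_nth (\<Phi> ^ Suc k) (n - k))"
        unfolding coeff sum.atMost_Suc_shift by simp
      also have "\<dots> = (\<Sum>k<N. if n < k then 0 else fps_nth P (Suc k) * fps_nth (\<Phi> ^ Suc k) (n - k))"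
        using n by (intro sum.mono_neutral_cong_left) auto
      finally show ?thesis .
    qed
    then have "cmod (fps_nth H (Suc n)) * r ^ Suc n \<le>
        (\<Sum>k<N. cmod (if n < k then 0 else fps_nth P (Suc k) * fps_nth (\<Phi> ^ Suc k) (n - k))) * r ^ Suc n"
      using r by (auto intro!: mult_right_mono norm_sum)
    also have "\<dots> = (\<Sum>k<N. if n < k then 0 else cmod (fps_nth P (Suc k)) * r ^ Suc k * (cmod (fps_nth (\<Phi> ^ Suc k) (n - k)) * r ^ (n - k)))"
      unfolding sum_distrib_right
      by (intro sum.cong refl) (auto simp: norm_mult simp flip: power_add)
    finally show "cmod (fps_nth H (Suc n)) * r ^ Suc n \<le> \<dots>" .
  qed
  also have "\<dots> = (\<Sum>k<N. cmod (fps_nth P (Suc k)) * r ^ Suc k * (\<Sum>n\<in>{k..<N}. cmod (fps_nth (\<Phi> ^ Suc k) (n - k)) * r ^ (n - k)))"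
    unfolding sum_distrib_left
    by (rule trans[OF sum.swap], rule sum.cong[OF refl], rule sum.mono_neutral_cong_right) auto
  also have "\<dots> \<le> (\<Sum>k<N. cmod (fps_nth P (Suc k)) * r ^ Suc k * 1)"
  proof (intro sum_mono mult_left_mono)
    fix k
    have "(\<Sum>n\<in>{k..<N}. cmod (fps_nth (\<Phi> ^ Suc k) (n - k)) * r ^ (n - k))
        = (\<Sum>m<N - k. cmod (fps_nth (\<Phi> ^ Suc k) m) * r ^ m)"
      by (rule sum.reindex_bij_witness[of _ "\<lambda>m. m + k" "\<lambda>n. n - k"]) auto
    also have "\<dots> \<le> 1"
      by (rule bohr_inequality[OF _ has_fps_expansion_power[OF \<Phi>] _ r])
         (use \<phi>1 in \<open>auto intro!: holomorphic_intros \<phi>(1) power_le_one simp: norm_power simp del: power_Suc\<close>)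
    finally show "(\<Sum>n\<in>{k..<N}. cmod (fps_nth (\<Phi> ^ Suc k) (n - k)) * r ^ (n - k)) \<le> 1" .
  qed (use r in auto)
  finally show ?thesis by simp
qed

text \<open>The identity \<open>g' = \<phi> * h'\<close> bounds \<open>Suc n\<close> times a
  coefficient of \<open>g\<close> by a convolution with factors \<open>Suc (n - i)\<close>. These
  never exceed \<open>Suc n\<close>, so the differentiation can be undone term by term; Bohr's
  inequality for \<open>\<phi>\<close>, bounded by \<open>k\<close>, does the rest.\<close>

lemma dilatation_coeff_sum_le:
  assumes h: "h holomorphic_on ball 0 1" "h has_fps_expansion H"
    and g: "g holomorphic_on ball 0 1" "g has_fps_expansion G"
    and nz: "\<And>z. cmod z < 1 \<Longrightarrow> deriv h z \<noteq> 0"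
    and le: "\<And>z. cmod z < 1 \<Longrightarrow> cmod (deriv g z) \<le> k * cmod (deriv h z)"
    and r: "0 \<le> r" "r \<le> 1 / 3"
  shows "(\<Sum>n<N. cmod (fps_nth G (Suc n)) * r ^ Suc n) \<le> k * (\<Sum>n<N. cmod (fps_nth H (Suc n)) * r ^ Suc n)"
proof -
  define \<phi> where "\<phi> = (\<lambda>z. deriv g z / deriv h z)"
  have hol: "\<phi> holomorphic_on ball 0 1"
    unfolding \<phi>_def using nz by (intro holomorphic_intros h g) auto
  define \<Phi> where "\<Phi> = fps_expansion \<phi> 0"
  have \<Phi>: "\<phi> has_fps_expansion \<Phi>" unfolding \<Phi>_def by (rule holomorphic_has_fps_expansion[OF hol])
  have bd: "cmod (\<phi> z) \<le> k" if "cmod z < 1" for z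
    using le[OF that] nz[OF that] by (simp add: \<phi>_def norm_divide divide_le_eq)
  have "\<Phi> * fps_deriv H = fps_deriv G"
    by (rule fps_expansion_mult_eq[OF \<Phi> has_fps_expansion_deriv[OF h(2)] has_fps_expansion_deriv[OF g(2)]])
       (use nz in \<open>auto simp: \<phi>_def\<close>)
  then have conv: "fps_nth (fps_deriv G) n = (\<Sum>i\<le>n. fps_nth \<Phi> i * fps_nth (fps_deriv H) (n - i))" for n
    by (metis fps_mult_nth atMost_atLeast0)
  define x where "x = (\<lambda>i. cmod (fps_nth \<Phi> i) * r ^ i)"
  define y where "y = (\<lambda>i. cmod (fps_nth H (Suc i)) * r ^ Suc i)"
  have xy: "x i \<ge> 0" "y i \<ge> 0" for i using r by (auto simp: x_def y_def)
  have "(\<Sum>n<N. cmod (fps_nth G (Suc n)) * r ^ Suc n) \<le> (\<Sum>n<N. \<Sum>i\<le>n. x i * y (n - i))"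
  proof (rule sum_mono)
    fix n
    have "real (Suc n) * cmod (fps_nth G (Suc n)) = cmod (fps_nth (fps_deriv G) n)"
      by (simp add: norm_mult del: of_nat_Suc)
    also have "\<dots> \<le> (\<Sum>i\<le>n. cmod (fps_nth \<Phi> i) * (real (Suc (n - i)) * cmod (fps_nth H (Suc (n - i)))))"
      unfolding conv by (rule order.trans[OF norm_sum]) (simp add: norm_mult del: of_nat_Suc)
    also have "\<dots> \<le> (\<Sum>i\<le>n. cmod (fps_nth \<Phi> i) * (real (Suc n) * cmod (fps_nth H (Suc (n - i)))))"
      by (intro sum_mono mult_left_mono mult_right_mono) auto
    also have "\<dots> = real (Suc n) * (\<Sum>i\<le>n. cmod (fps_nth \<Phi> i) * cmod (fps_nth H (Suc (n - i))))"
      by (simp add: sum_distrib_left mult_ac)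
    finally have "cmod (fps_nth G (Suc n)) \<le> (\<Sum>i\<le>n. cmod (fps_nth \<Phi> i) * cmod (fps_nth H (Suc (n - i))))"
      by (simp del: of_nat_Suc)
    then have "cmod (fps_nth G (Suc n)) * r ^ Suc n \<le>
        (\<Sum>i\<le>n. cmod (fps_nth \<Phi> i) * cmod (fps_nth H (Suc (n - i)))) * r ^ Suc n"
      using r by (intro mult_right_mono) auto
    also have "\<dots> = (\<Sum>i\<le>n. x i * y (n - i))"
      unfolding sum_distrib_right x_def y_def
    proof (intro sum.cong refl)
      fix i assume "i \<in> {..n}"
      then have "r ^ Suc n = r ^ i * r ^ Suc (n - i)" by (simp flip: power_add)
      then show "cmod (fps_nth \<Phi> i) * cmod (fps_nth H (Suc (n - i))) * r ^ Suc n =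
          cmod (fps_nth \<Phi> i) * r ^ i * (cmod (fps_nth H (Suc (n - i))) * r ^ Suc (n - i))"
        by (simp only: mult_ac)
    qed
    finally show "cmod (fps_nth G (Suc n)) * r ^ Suc n \<le> (\<Sum>i\<le>n. x i * y (n - i))" .
  qed
  also have "\<dots> = (\<Sum>(i, j)\<in>{(i, j). i + j < N}. x i * y j)"
    by (rule sum.triangle_reindex[symmetric])
  \<comment> \<open>The triangle \<open>i + j < N\<close> is filled up to a square, over which the
    double sum is a product.\<close>
  also have "\<dots> \<le> (\<Sum>(i, j)\<in>{..<N} \<times> {..<N}. x i * y j)"
    using xy by (intro sum_mono2) auto
  also have "\<dots> = (\<Sum>i<N. x i) * (\<Sum>j<N. y j)"
    by (simp add: sum_product sum.cartesian_product)
  also have "\<dots> \<le> k * (\<Sum>j<N. y j)"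
    using bohr_inequality[OF hol \<Phi> bd r, of N] xy
    by (intro mult_right_mono) (auto simp: x_def intro!: sum_nonneg)
  finally show ?thesis by (simp add: y_def)
qed

section \<open>The majorant series of a univalent function\<close>

lemma koebe_series:
  fixes z :: complex
  assumes "cmod z < 1"
  shows "(\<lambda>n. of_nat n * z ^ n) sums (z / (1 - z)\<^sup>2)"
proof -
  have "(\<lambda>n. z * (of_nat (Suc n) * z ^ n)) sums (z * (1 / (1 - z)\<^sup>2))"
    by (intro sums_mult geometric_deriv_sums assms)
  then have "(\<lambda>n. of_nat (Suc n) * z ^ Suc n) sums (z / (1 - z)\<^sup>2)" by (simp add: mult_ac)
  from sums_Suc[OF this] show ?thesis by simp
qed

text \<open>The deviation is measured by \<open>\<eta>\<close>, at the level of \<open>q\<close>,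
  where the area theorem controls it: coefficient 0 vanishes, coefficient 1 is \<open>e / 2\<close>,
  and the area-weighted squares of the others sum to at most \<open>e\<close>. On
  \<open>cmod z = 1 / 3\<close> the deviation of \<open>f\<close> itself is at most 9/4 times as
  large.\<close>

lemma schlicht_deviation_from_koebe:
  assumes f: "schlicht f" and F: "f has_fps_expansion F" and A: "fps_nth F 2 = of_real A" "0 \<le> A"
  defines "e \<equiv> 2 - A"
  shows "(\<Sum>n. (cmod (fps_nth F n - of_nat n))\<^sup>2 * (1 / 3) ^ (2 * n)) \<le> 81 / 16 * (e\<^sup>2 / 36 + e / 243)"
    and "summable (\<lambda>n. (cmod (fps_nth F n - of_nat n))\<^sup>2 * (1 / 3) ^ (2 * n))"
proof -
  have holf: "f holomorphic_on ball 0 1" using f by (simp add: schlicht_def)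
  obtain q Q where q: "q holomorphic_on ball 0 1" and Q: "q has_fps_expansion Q" and Q0: "fps_nth Q 0 = 1"
    and qn0: "\<And>z. cmod z < 1 \<Longrightarrow> q z \<noteq> 0" and fq: "\<And>z. cmod z < 1 \<Longrightarrow> f z * (q z)\<^sup>2 = z"
    and F2: "fps_nth F 2 = - 2 * fps_nth Q 1"
    and area: "\<And>N. (\<Sum>n<N. real (2 * n + 1) * (cmod (fps_nth Q (Suc n)))\<^sup>2) \<le> 1"
    by (rule schlicht_inverse_sqrt[OF f F]) (rule that; assumption)
  have A2: "A \<le> 2" using schlicht_second_coeff_le[OF f F] A by simp
  have Q1: "fps_nth Q (Suc 0) = - of_real A / 2" using F2 A by simp
  define k where "k = (\<lambda>z::complex. z / (1 - z)\<^sup>2)"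
  have holk: "k holomorphic_on ball 0 1"
    unfolding k_def by (intro holomorphic_intros) auto
  have Kexp: "k has_fps_expansion Abs_fps of_nat"
    by (rule sums_imp_has_fps_expansion) (simp add: k_def koebe_series)
  define \<delta> where "\<delta> = (\<lambda>z. f z - k z)"
  define \<Delta> where "\<Delta> = F - Abs_fps of_nat"
  have d: "\<delta> holomorphic_on ball 0 1" "\<delta> has_fps_expansion \<Delta>"
    unfolding \<delta>_def \<Delta>_def by (intro holomorphic_intros holf holk, rule has_fps_expansion_diff[OF F Kexp])
  define \<eta> where "\<eta> = (\<lambda>z. q z - (1 - z))"
  define E where "E = Q - (1 - fps_X)"
  have eta: "\<eta> holomorphic_on ball 0 1" "\<eta> has_fps_expansion E"
    unfolding \<eta>_def E_def
    by (intro holomorphic_intros q,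
        intro has_fps_expansion_diff has_fps_expansion_1 has_fps_expansion_fps_X Q)
  \<comment> \<open>Here \<open>|f| |q|^2 = |z|\<close>, and the growth theorem bounds
    \<open>|f|\<close> from above.\<close>
  have q_lower: "1 - cmod z \<le> cmod (q z)" if z: "cmod z < 1" for z
  proof (cases "z = 0")
    case True
    then show ?thesis using Q0 fps_expansion_nth_low(1)[OF Q] by simp
  next
    case False
    have "cmod z = cmod (f z) * (cmod (q z))\<^sup>2" using fq[OF z] by (metis norm_mult norm_power)
    also have "\<dots> \<le> cmod z / (1 - cmod z)\<^sup>2 * (cmod (q z))\<^sup>2"
      by (intro mult_right_mono schlicht_growth f z) auto
    finally have "cmod z * 1 \<le> cmod z * ((cmod (q z))\<^sup>2 / (1 - cmod z)\<^sup>2)" by simp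
    then have "1 \<le> (cmod (q z))\<^sup>2 / (1 - cmod z)\<^sup>2"
      by (rule mult_left_le_imp_le) (use False in simp)
    then have "(1 - cmod z)\<^sup>2 \<le> (cmod (q z))\<^sup>2" using z by (simp add: le_divide_eq split: if_splits)
    then show ?thesis by (rule power2_le_imp_le) simp
  qed
  \<comment> \<open>The difference \<open>z / q^2 - z / (1 - z)^2\<close> contains the factor
    \<open>\<eta> z\<close>. As \<open>|q|\<close> and \<open>|1 - z|\<close> are at least 2/3, each
    remaining fraction is at most 27/8, and \<open>1/3 * (27/8 + 27/8) = 9/4\<close>.\<close>
  have bound: "cmod (\<delta> z) \<le> cmod (of_real (9 / 4) * \<eta> z)" if z: "cmod z = 1 / 3" for z
  proof -
    have z1: "cmod z < 1" "z \<noteq> 1" using z by auto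
    have lq: "2 / 3 \<le> cmod (q z)" using q_lower[OF z1(1)] z by simp
    have lz: "2 / 3 \<le> cmod (1 - z)" using norm_triangle_ineq2[of 1 z] z by simp
    have "f z = z / (q z)\<^sup>2" using fq[OF z1(1)] qn0[OF z1(1)] by (simp add: field_simps)
    moreover have "w / x\<^sup>2 - w / y\<^sup>2 = - w * (x - y) * (1 / (x\<^sup>2 * y) + 1 / (x * y\<^sup>2))"
      if "x \<noteq> 0" "y \<noteq> 0" for w x y :: complex
      using that by (simp add: divide_simps) (simp add: power2_eq_square algebra_simps)
    ultimately have "\<delta> z = - z * \<eta> z * (1 / ((q z)\<^sup>2 * (1 - z)) + 1 / (q z * (1 - z)\<^sup>2))"
      unfolding \<delta>_def k_def \<eta>_def using qn0[OF z1(1)] z1(2) by simp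
    then have "cmod (\<delta> z) = 1 / 3 * cmod (\<eta> z) * cmod (1 / ((q z)\<^sup>2 * (1 - z)) + 1 / (q z * (1 - z)\<^sup>2))"
      by (simp add: norm_mult z)
    also have "\<dots> \<le> 1 / 3 * cmod (\<eta> z) * (27 / 8 + 27 / 8)"
    proof (intro mult_left_mono order.trans[OF norm_triangle_ineq] add_mono)
      have "(2 / 3)\<^sup>2 * (2 / 3) \<le> (cmod (q z))\<^sup>2 * cmod (1 - z)"
        using lq lz by (intro mult_mono power_mono) auto
      then have "1 / ((cmod (q z))\<^sup>2 * cmod (1 - z)) \<le> 1 / ((2 / 3)\<^sup>2 * (2 / 3))"
        by (intro divide_left_mono) (auto intro!: mult_pos_pos simp: qn0[OF z1(1)] z1(2))
      then show "cmod (1 / ((q z)\<^sup>2 * (1 - z))) \<le> 27 / 8"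
        by (simp add: norm_divide norm_mult norm_power power2_eq_square)
      have "(2 / 3) * (2 / 3)\<^sup>2 \<le> cmod (q z) * (cmod (1 - z))\<^sup>2"
        using lq lz by (intro mult_mono power_mono) auto
      then have "1 / (cmod (q z) * (cmod (1 - z))\<^sup>2) \<le> 1 / ((2 / 3) * (2 / 3)\<^sup>2)"
        by (intro divide_left_mono) (auto intro!: mult_pos_pos simp: qn0[OF z1(1)] z1(2))
      then show "cmod (1 / (q z * (1 - z)\<^sup>2)) \<le> 27 / 8"
        by (simp add: norm_divide norm_mult norm_power power2_eq_square)
    qed auto
    finally show ?thesis by (simp add: norm_mult)
  qed
  define t where "t = (\<lambda>n. (cmod (fps_nth E n))\<^sup>2 * (1 / 3) ^ (2 * n))"
  have eta2: "(\<lambda>z. of_real (9 / 4) * \<eta> z) holomorphic_on ball 0 1"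
      "(\<lambda>z. of_real (9 / 4) * \<eta> z) has_fps_expansion fps_const (of_real (9 / 4)) * E"
    by (rule holomorphic_on_mult[OF holomorphic_on_const eta(1)], rule has_fps_expansion_cmult_left[OF eta(2)])
  have St: "summable t"
    using parseval_circle(1)[OF eta, of "1 / 3"] by (simp add: sums_iff t_def)
  have "(\<Sum>n. (cmod (fps_nth \<Delta> n))\<^sup>2 * (1 / 3) ^ (2 * n))
      \<le> (\<Sum>n. (cmod (fps_nth (fps_const (of_real (9 / 4)) * E) n))\<^sup>2 * (1 / 3) ^ (2 * n))"
    by (rule power_series_l2_mono[OF d eta2 bound]) auto
  also have "\<dots> = (\<Sum>n. 81 / 16 * t n)"
    by (simp add: t_def norm_mult power_mult_distrib power2_eq_square mult_ac)
  also have "\<dots> = 81 / 16 * (\<Sum>n. t n)"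
    using St by (rule suminf_mult)
  also have "(\<Sum>n. t n) \<le> e\<^sup>2 / 36 + e / 243"
  proof (rule suminf_le_const[OF St])
    fix M
    have "(\<Sum>n<M. t n) \<le> (\<Sum>n<Suc (Suc M). t n)"
      by (intro sum_mono2) (auto simp: t_def)
    also have "\<dots> = t 0 + t 1 + (\<Sum>n<M. t (Suc (Suc n)))"
      unfolding sum.lessThan_Suc_shift by simp
    also have "t 0 = 0" by (simp add: t_def E_def Q0)
    also have "t 1 = e\<^sup>2 / 36"
    proof -
      have "fps_nth E 1 = of_real (e / 2)" by (simp add: E_def Q1 e_def diff_divide_distrib)
      then show ?thesis by (simp add: t_def power_divide del: of_real_divide)
    qed
    \<comment> \<open>Index \<open>n + 2\<close> has Parseval weight at most 1/81, while its area
      weight \<open>2 * Suc n + 1\<close> is at least 3; the quotient is 1/243.\<close>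
    also have "(\<Sum>n<M. t (Suc (Suc n))) \<le> (\<Sum>n<M. 1 / 243 * (real (2 * Suc n + 1) * (cmod (fps_nth Q (Suc (Suc n))))\<^sup>2))"
    proof (rule sum_mono)
      fix n
      have "(1 / 3 :: real) ^ (2 * Suc (Suc n)) = (1 / 81) * (1 / 9) ^ n"
        by (simp add: power_mult power2_eq_square)
      also have "\<dots> \<le> (1 / 81) * 1" by (intro mult_left_mono power_le_one) auto
      also have "\<dots> \<le> 1 / 243 * real (2 * Suc n + 1)" by simp
      finally have "(cmod (fps_nth Q (Suc (Suc n))))\<^sup>2 * (1 / 3) ^ (2 * Suc (Suc n))
          \<le> (cmod (fps_nth Q (Suc (Suc n))))\<^sup>2 * (1 / 243 * real (2 * Suc n + 1))"
        by (rule mult_left_mono) auto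
      then show "t (Suc (Suc n)) \<le> 1 / 243 * (real (2 * Suc n + 1) * (cmod (fps_nth Q (Suc (Suc n))))\<^sup>2)"
        by (simp add: t_def E_def mult_ac del: power_Suc of_nat_Suc)
    qed
    also have "\<dots> = 1 / 243 * (\<Sum>n<M. real (2 * Suc n + 1) * (cmod (fps_nth Q (Suc (Suc n))))\<^sup>2)"
      by (simp only: sum_distrib_left)
    also have "(\<Sum>n<M. real (2 * Suc n + 1) * (cmod (fps_nth Q (Suc (Suc n))))\<^sup>2) \<le> e"
    proof -
      have "(\<Sum>n<Suc M. real (2 * n + 1) * (cmod (fps_nth Q (Suc n)))\<^sup>2) =
         (A / 2)\<^sup>2 + (\<Sum>n<M. real (2 * Suc n + 1) * (cmod (fps_nth Q (Suc (Suc n))))\<^sup>2)"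
        unfolding sum.lessThan_Suc_shift using A(2) by (simp add: Q1 norm_divide power_divide)
      moreover have "1 - (A / 2)\<^sup>2 \<le> e"
        using zero_le_power2[of "2 - A"] by (simp add: e_def power2_eq_square algebra_simps)
      ultimately show ?thesis using area[of "Suc M"] by linarith
    qed
    finally show "(\<Sum>n<M. t n) \<le> e\<^sup>2 / 36 + e / 243" by simp
  qed
  finally show "(\<Sum>n. (cmod (fps_nth F n - of_nat n))\<^sup>2 * (1 / 3) ^ (2 * n)) \<le> 81 / 16 * (e\<^sup>2 / 36 + e / 243)"
    by (simp add: \<Delta>_def)
  show "summable (\<lambda>n. (cmod (fps_nth F n - of_nat n))\<^sup>2 * (1 / 3) ^ (2 * n))"
    using parseval_circle(1)[OF d, of "1 / 3"] by (simp add: sums_iff \<Delta>_def)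
qed

text \<open>On \<open>cmod z = 1 / 2\<close> the growth theorem gives
  \<open>cmod (f z) \<le> 2\<close>; the comparison with the constant 2 takes the part of Cauchy's
  estimate.\<close>

lemma schlicht_coeff_crude_bound:
  assumes f: "schlicht f" and F: "f has_fps_expansion F"
  shows "cmod (fps_nth F n) \<le> 2 * 2 ^ n"
proof -
  have hol: "f holomorphic_on ball 0 1" using f by (simp add: schlicht_def)
  have bd: "cmod (f z) \<le> cmod 2" if "cmod z = 1 / 2" for z
    using schlicht_growth[OF f, of z] that by (simp add: power2_eq_square)
  have s: "summable (\<lambda>n. (cmod (fps_nth F n))\<^sup>2 * (1 / 2) ^ (2 * n))"
    using parseval_circle(1)[OF hol F, of "1 / 2"] by (simp add: sums_iff)
  have "(\<Sum>m\<in>{n}. (cmod (fps_nth F m))\<^sup>2 * (1 / 2) ^ (2 * m)) \<le> (\<Sum>n. (cmod (fps_nth F n))\<^sup>2 * (1 / 2) ^ (2 * n))"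
    by (rule sum_le_suminf[OF s]) auto
  also have "\<dots> \<le> (\<Sum>n. (cmod (fps_nth (fps_const 2 :: complex fps) n))\<^sup>2 * (1 / 2) ^ (2 * n))"
    by (rule power_series_l2_mono[OF hol F _ has_fps_expansion_const bd]) (auto intro: holomorphic_intros)
  also have "\<dots> = (\<Sum>m\<in>{0}. (cmod (fps_nth (fps_const 2 :: complex fps) m))\<^sup>2 * (1 / 2) ^ (2 * m))"
    by (rule suminf_finite) auto
  finally have "(cmod (fps_nth F n) * (1 / 2) ^ n)\<^sup>2 \<le> 2\<^sup>2"
    by (simp add: power_mult_distrib flip: power_mult) (simp add: mult.commute)
  then have "cmod (fps_nth F n) * (1 / 2) ^ n \<le> 2" by (rule power2_le_imp_le) simp
  then show ?thesis by (simp add: field_simps)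
qed

lemma koebe_lower:
  fixes r :: real
  assumes "0 \<le> r" "r < 1"
  shows "r + 2 * r\<^sup>2 \<le> r / (1 - r)\<^sup>2"
proof -
  have "(1 + 2 * r) * (1 - r)\<^sup>2 = 1 - r\<^sup>2 * (3 - 2 * r)" by (simp add: power2_eq_square algebra_simps)
  also have "\<dots> \<le> 1" using assms by simp
  finally have "r * ((1 + 2 * r) * (1 - r)\<^sup>2) \<le> r * 1" using assms by (intro mult_left_mono) auto
  then show ?thesis using assms by (simp add: pos_le_divide_eq) (simp add: power2_eq_square algebra_simps)
qed

lemma schlicht_coeff_sum_le_normalised:
  assumes f: "schlicht f" and F: "f has_fps_expansion F" and A: "fps_nth F 2 = of_real A" "0 \<le> A"
    and r: "0 \<le> r" "r \<le> 1 / 9"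
  shows "(\<Sum>n<N. cmod (fps_nth F (Suc n)) * r ^ Suc n) \<le> r / (1 - r)\<^sup>2 * (1 + (2 - A) / 4)"
proof -
  have hol: "f holomorphic_on ball 0 1" and f0: "f 0 = 0" "deriv f 0 = 1"
    using f by (auto simp: schlicht_def)
  have F01: "fps_nth F 0 = 0" "fps_nth F (Suc 0) = 1" using fps_expansion_nth_low[OF F] f0 by auto
  have r1: "r < 1" using r by simp
  define e where "e = 2 - A"
  have A2: "A \<le> 2" using schlicht_second_coeff_le[OF f F] A by simp
  have e: "0 \<le> e" using A2 by (simp add: e_def)
  have Kr: "r + 2 * r\<^sup>2 \<le> r / (1 - r)\<^sup>2" by (rule koebe_lower[OF r(1) r1])
  show ?thesis
  proof (cases "e \<le> 1")
    case True
    define D where "D = (\<lambda>n. (cmod (fps_nth F n - of_nat n))\<^sup>2 * (1 / 3) ^ (2 * n))"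
    have D: "summable D" "suminf D \<le> 81 / 16 * (e\<^sup>2 / 36 + e / 243)"
      using schlicht_deviation_from_koebe[OF f F A] by (auto simp: D_def e_def)
    define m where "m = (\<lambda>n. cmod (fps_nth F n) * r ^ n)"
    have m: "summable m" unfolding m_def by (rule fps_expansion_abs_summable[OF hol F r(1) r1])
    have "(\<lambda>n. fps_nth F n * of_real r ^ n) sums f (of_real r)"
      using r r1 by (intro fps_expansion_sums[OF hol F]) auto
    from sums_Re[OF this] have Ref: "(\<lambda>n. Re (fps_nth F n) * r ^ n) sums Re (f (of_real r))"
      by (simp flip: of_real_power)
    \<comment> \<open>For \<open>n < 3\<close> the normalisation makes the coefficient real and
      nonnegative, so there is no error. From \<open>n = 3\<close> on, \<open>1 / (2 * n)\<close> is
      at most 1/6 and \<open>r ^ n\<close> at most \<open>9 * r * (1 / 3) ^ (2 * n)\<close>, which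
      gives the constant 9/6.\<close>
    have term_le: "m n \<le> Re (fps_nth F n) * r ^ n + 3 / 2 * r * D n" for n
    proof (cases "n < 3")
      case True
      then have "n = 0 \<or> n = 1 \<or> n = 2" by auto
      then have "cmod (fps_nth F n) = Re (fps_nth F n)" using F01 A by auto
      then show ?thesis using r by (simp add: m_def D_def)
    next
      case False
      define c where "c = fps_nth F n"
      have n3: "real n \<ge> 3" using False by simp
      \<comment> \<open>The two sides of the next inequality differ by exactly this square.\<close>
      have "(cmod c - real n)\<^sup>2 \<ge> 0" by simp
      then have "2 * real n * (cmod c - Re c) \<le> (cmod (c - of_nat n))\<^sup>2"
        unfolding cmod_power2 by (simp add: power2_diff cmod_power2 algebra_simps)
      moreover have "6 * (cmod c - Re c) \<le> 2 * real n * (cmod c - Re c)"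
        using n3 complex_Re_le_cmod[of c] by (intro mult_right_mono) auto
      ultimately have c: "cmod c - Re c \<le> (cmod (c - of_nat n))\<^sup>2 / 6" by simp
      have rn: "r ^ n \<le> 9 * r * (1 / 3) ^ (2 * n)"
      proof -
        obtain l where l: "n = Suc l" using False by (cases n) auto
        have "r * r ^ l \<le> r * (1 / 9) ^ l" using r by (intro mult_left_mono power_mono) auto
        then show ?thesis by (simp add: l power_mult power2_eq_square)
      qed
      have "(cmod c - Re c) * r ^ n \<le> (cmod (c - of_nat n))\<^sup>2 / 6 * (9 * r * (1 / 3) ^ (2 * n))"
        using r by (intro mult_mono c rn) auto
      then show ?thesis by (simp add: m_def D_def c_def algebra_simps)
    qed
    have "(\<Sum>n<N. cmod (fps_nth F (Suc n)) * r ^ Suc n) = (\<Sum>n<Suc N. m n)"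
      unfolding sum.lessThan_Suc_shift by (simp add: m_def F01)
    also have "\<dots> \<le> suminf m" using r by (intro sum_le_suminf m) (auto simp: m_def)
    also have "\<dots> \<le> (\<Sum>n. Re (fps_nth F n) * r ^ n + 3 / 2 * r * D n)"
      using Ref by (intro suminf_le term_le m summable_add summable_mult D(1)) (auto simp: sums_iff)
    also have "\<dots> = Re (f (of_real r)) + 3 / 2 * r * suminf D"
    proof -
      have "(\<lambda>n. Re (fps_nth F n) * r ^ n + 3 / 2 * r * D n) sums (Re (f (of_real r)) + 3 / 2 * r * suminf D)"
        by (intro sums_add Ref sums_mult summable_sums D(1))
      then show ?thesis by (simp add: sums_iff)
    qed
    also have "Re (f (of_real r)) \<le> r / (1 - r)\<^sup>2"
      using schlicht_growth[OF f, of "of_real r"] r r1 complex_Re_le_cmod[of "f (of_real r)"] by simp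
    also have "3 / 2 * r * suminf D \<le> 3 / 2 * r * (81 / 16 * (e\<^sup>2 / 36 + e / 243))"
      using r D(2) by (intro mult_left_mono) auto
    also have "\<dots> \<le> r * (e / 4)"
    proof -
      \<comment> \<open>With it the total constant is
        \<open>243/32 * (1/36 + 1/243) = 31/128\<close>, just below 1/4.\<close>
      have "e\<^sup>2 \<le> e" using True e by (simp add: power2_eq_square mult_left_le)
      then have "3 / 2 * (81 / 16 * (e\<^sup>2 / 36 + e / 243)) \<le> e / 4" using e by simp
      from mult_left_mono[OF this r(1)] show ?thesis by (simp add: mult_ac)
    qed
    also have "r * (e / 4) \<le> r / (1 - r)\<^sup>2 * (e / 4)"
      using Kr r e by (intro mult_right_mono) (auto intro: order.trans[rotated])
    finally show ?thesis by (simp add: e_def algebra_simps)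
  next
    case False
    \<comment> \<open>For \<open>e > 1\<close> there is room: \<open>A = 2 - e\<close> and the
      factor \<open>1 + e / 4\<close> together gain \<open>r * e * (1/4 + 3/2 * r)\<close>, at least
      what the crude tail \<open>16 * r ^ 3 * (9 / 7)\<close> costs. The range is extended by two
      terms so that the first two can be split off for every \<open>N\<close>.\<close>
    have "(\<Sum>n<N. cmod (fps_nth F (Suc n)) * r ^ Suc n) \<le> (\<Sum>n<Suc (Suc N). cmod (fps_nth F (Suc n)) * r ^ Suc n)"
      using r by (intro sum_mono2) auto
    also have "\<dots> = r + A * r\<^sup>2 + (\<Sum>n<N. cmod (fps_nth F (Suc (Suc (Suc n)))) * r ^ Suc (Suc (Suc n)))"
      unfolding sum.lessThan_Suc_shift using F01 A by (simp add: power2_eq_square flip: numeral_2_eq_2)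
    also have "(\<Sum>n<N. cmod (fps_nth F (Suc (Suc (Suc n)))) * r ^ Suc (Suc (Suc n)))
        \<le> (\<Sum>n<N. 16 * r ^ 3 * (2 / 9) ^ n)"
    proof (rule sum_mono)
      fix n
      have "cmod (fps_nth F (Suc (Suc (Suc n)))) * r ^ Suc (Suc (Suc n))
          \<le> 2 * 2 ^ Suc (Suc (Suc n)) * r ^ Suc (Suc (Suc n))"
        using r by (intro mult_right_mono schlicht_coeff_crude_bound[OF f F]) auto
      also have "\<dots> = 16 * r ^ 3 * (2 * r) ^ n"
        by (simp add: power3_eq_cube power_mult_distrib)
      also have "\<dots> \<le> 16 * r ^ 3 * (2 / 9) ^ n"
        using r by (intro mult_left_mono power_mono) auto
      finally show "cmod (fps_nth F (Suc (Suc (Suc n)))) * r ^ Suc (Suc (Suc n)) \<le> 16 * r ^ 3 * (2 / 9) ^ n" .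
    qed
    also have "\<dots> = 16 * r ^ 3 * (\<Sum>n<N. (2 / 9) ^ n)" by (simp add: sum_distrib_left)
    also have "(\<Sum>n<N. (2 / 9 :: real) ^ n) \<le> 9 / 7"
    proof -
      have "(\<Sum>n<N. (2 / 9 :: real) ^ n) = (1 - (2 / 9) ^ N) * (9 / 7)"
        by (induction N) (simp_all add: algebra_simps)
      then show ?thesis by simp
    qed
    finally have "(\<Sum>n<N. cmod (fps_nth F (Suc n)) * r ^ Suc n) \<le> r + A * r\<^sup>2 + 16 * r ^ 3 * (9 / 7)"
      using r by (simp add: mult_left_mono)
    also have "\<dots> \<le> (r + 2 * r\<^sup>2) * (1 + e / 4)"
    proof -
      have "144 / 7 * r * r \<le> 144 / 7 * (1 / 9) * r" using r by (intro mult_right_mono mult_left_mono) auto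
      also have "\<dots> \<le> 1 / 4 + 3 / 2 * r" using r by simp
      also have "\<dots> \<le> e * (1 / 4 + 3 / 2 * r)" using False r mult_right_mono[of 1 e "1 / 4 + 3 / 2 * r"] by simp
      finally have "r * (144 / 7 * r * r) \<le> r * (e * (1 / 4 + 3 / 2 * r))"
        using r by (intro mult_left_mono) auto
      moreover have "(r + 2 * r\<^sup>2) * (1 + e / 4) - (r + (2 - e) * r\<^sup>2 + 16 * r ^ 3 * (9 / 7)) =
          r * (e * (1 / 4 + 3 / 2 * r)) - r * (144 / 7 * r * r)"
        by (simp add: power2_eq_square power3_eq_cube field_simps)
      ultimately have "r + (2 - e) * r\<^sup>2 + 16 * r ^ 3 * (9 / 7) \<le> (r + 2 * r\<^sup>2) * (1 + e / 4)" by linarith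
      then show ?thesis by (simp add: e_def)
    qed
    also have "\<dots> \<le> r / (1 - r)\<^sup>2 * (1 + e / 4)"
      using Kr e by (intro mult_right_mono) auto
    finally show ?thesis by (simp add: e_def)
  qed
qed

text \<open>The rotation \<open>f (u * z) / u\<close> keeps all moduli and turns the second
  coefficient into \<open>u * fps_nth F 2\<close>, which is nonnegative when \<open>u\<close> is the
  conjugate sign.\<close>

lemma schlicht_coeff_sum_le:
  assumes f: "schlicht f" and F: "f has_fps_expansion F" and r: "0 \<le> r" "r \<le> 1 / 9"
  shows "(\<Sum>n<N. cmod (fps_nth F (Suc n)) * r ^ Suc n) \<le> r / (1 - r)\<^sup>2 * (1 + (2 - cmod (fps_nth F 2)) / 4)"
proof -
  define u where "u = (if fps_nth F 2 = 0 then 1 else cnj (sgn (fps_nth F 2)))"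
  have u: "cmod u = 1" by (simp add: u_def norm_sgn)
  then have u0: "u \<noteq> 0" by auto
  have hol: "f holomorphic_on ball 0 1" using f by (simp add: schlicht_def)
  have g: "schlicht (\<lambda>z. f (u * z) / u)" by (rule schlicht_rotation[OF f u])
  define G where "G = Abs_fps (\<lambda>n. fps_nth F n * u ^ n / u)"
  have G: "(\<lambda>z. f (u * z) / u) has_fps_expansion G"
    unfolding G_def
  proof (rule sums_imp_has_fps_expansion)
    fix z :: complex assume "cmod z < 1"
    then have "(\<lambda>n. fps_nth F n * (u * z) ^ n / u) sums (f (u * z) / u)"
      by (intro sums_divide fps_expansion_sums[OF hol F]) (simp add: norm_mult u)
    then show "(\<lambda>n. fps_nth F n * u ^ n / u * z ^ n) sums (f (u * z) / u)"
      by (simp add: power_mult_distrib mult_ac)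
  qed
  have "fps_nth G 2 = of_real (cmod (fps_nth F 2))"
  proof (cases "fps_nth F 2 = 0")
    case False
    have "fps_nth F 2 * cnj (sgn (fps_nth F 2)) = of_real (cmod (fps_nth F 2))"
    proof -
      have "fps_nth F 2 = of_real (cmod (fps_nth F 2)) * sgn (fps_nth F 2)"
        using False by (simp add: sgn_eq)
      then have "fps_nth F 2 * cnj (sgn (fps_nth F 2)) =
          of_real (cmod (fps_nth F 2)) * (sgn (fps_nth F 2) * cnj (sgn (fps_nth F 2)))" by (metis mult.assoc)
      also have "sgn (fps_nth F 2) * cnj (sgn (fps_nth F 2)) = 1"
        using False by (metis complex_norm_square norm_sgn of_real_1 one_power2)
      finally show ?thesis by simp
    qed
    then show ?thesis using False u0 by (simp add: G_def u_def power2_eq_square)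
  qed (simp add: G_def)
  from schlicht_coeff_sum_le_normalised[OF g G this _ r, of N]
  show ?thesis by (simp add: G_def norm_mult norm_divide norm_power u u0)
qed

section \<open>The Bohr-type inequality\<close>

text \<open>Otherwise the inverse would be a bounded entire function, constant by Liouville. This
  guarantees a nonempty frontier; \<open>infdist\<close> to the empty set would be 0 and could not
  satisfy a positive lower bound.\<close>

lemma univalent_image_neq_UNIV:
  assumes "f holomorphic_on ball 0 1" "inj_on f (ball 0 1)"
  shows "f ` ball 0 1 \<noteq> UNIV"
proof
  assume U: "f ` ball 0 1 = UNIV"
  obtain g where g: "g holomorphic_on f ` ball 0 1" "\<And>z. z \<in> ball 0 1 \<Longrightarrow> g (f z) = z"
    using holomorphic_has_inverse[OF assms(1) open_ball assms(2)] by metis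
  have "range g \<subseteq> ball 0 1"
  proof
    fix y assume "y \<in> range g"
    then obtain w where w: "y = g w" by blast
    obtain v where "v \<in> ball 0 1" "w = f v" using U by blast
    then show "y \<in> ball 0 1" using g(2)[of v] w by simp
  qed
  then have "bounded (range g)" using bounded_ball bounded_subset by blast
  moreover have "g holomorphic_on UNIV" using g(1) U by simp
  ultimately have "g constant_on UNIV" by (intro Liouville_theorem)
  then have "g (f 0) = g (f (1 / 2))" by (auto simp: constant_on_def)
  then show False using g(2)[of 0] g(2)[of "1 / 2"] by simp
qed

text \<open>The image is open, so frontier points are omitted values, to which
  \<open>schlicht_omitted_value\<close> applies after normalisation.\<close>

lemma univalent_infdist_frontier_ge:
  assumes hol: "f holomorphic_on ball 0 1" and inj: "inj_on f (ball 0 1)"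
    and G: "(\<lambda>z. (f z - f 0) / deriv f 0) has_fps_expansion G"
  shows "cmod (deriv f 0) / (2 + cmod (fps_nth G 2)) \<le> infdist (f 0) (frontier (f ` ball 0 1))"
proof -
  have op: "open (f ` ball 0 1)" by (rule open_mapping_thm3[OF hol open_ball inj])
  have ne: "frontier (f ` ball 0 1) \<noteq> {}"
    using univalent_image_neq_UNIV[OF hol inj] by (simp add: frontier_eq_empty)
  have d0: "deriv f 0 \<noteq> 0" using univalent_deriv_nonzero[OF hol inj, of 0] by simp
  have "cmod (deriv f 0) / (2 + cmod (fps_nth G 2)) \<le> dist (f 0) w" if w: "w \<in> frontier (f ` ball 0 1)" for w
  proof -
    have "w \<notin> f ` ball 0 1" using w op frontier_disjoint_eq by blast
    then have "(w - f 0) / deriv f 0 \<notin> (\<lambda>z. (f z - f 0) / deriv f 0) ` ball 0 1"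
      using d0 by (auto simp: divide_cancel_right)
    from schlicht_omitted_value[OF univalent_normalised[OF hol inj] G this]
    have "cmod (deriv f 0) \<le> cmod (w - f 0) * (2 + cmod (fps_nth G 2))"
      using d0 by (simp add: norm_divide field_simps)
    moreover have "2 + cmod (fps_nth G 2) > 0" using norm_ge_zero[of "fps_nth G 2"] by linarith
    ultimately show ?thesis by (simp add: pos_divide_le_eq dist_norm norm_minus_commute)
  qed
  then show ?thesis unfolding infdist_notempty[OF ne] using ne by (intro cINF_greatest) auto
qed

section \<open>The dilatation bound for harmonic mappings, and the constants\<close>

lemma harmonic_has_derivative:
  assumes h: "h holomorphic_on ball 0 1" and g: "g holomorphic_on ball 0 1"
    and f: "\<And>z. cmod z < 1 \<Longrightarrow> f z = h z + cnj (g z)" and z: "cmod z < 1"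
  shows "(f has_derivative (\<lambda>v. deriv h z * v + cnj (deriv g z * v))) (at z)"
proof -
  have "(h has_derivative (\<lambda>v. deriv h z * v)) (at z)" "(g has_derivative (\<lambda>v. deriv g z * v)) (at z)"
    using holomorphic_derivI[OF h, of z] holomorphic_derivI[OF g, of z] z
    by (auto simp: has_field_derivative_def)
  then have "((\<lambda>z. h z + cnj (g z)) has_derivative (\<lambda>v. deriv h z * v + cnj (deriv g z * v))) (at z)"
    by (intro has_derivative_add bounded_linear.has_derivative[OF bounded_linear_cnj])
  then show ?thesis
    by (rule has_derivative_transform_within_open[of _ _ _ _ "ball 0 1"]) (use f z in auto)
qed

text \<open>The points violating the bound form an open set, by continuity of the derivatives.
  Quasiconformality puts this set inside a null set, and an open null set is empty.\<close>

lemma quasiconformal_harmonic_dilatation: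
  assumes K: "K \<ge> 1" and k: "k = (K - 1) / (K + 1)"
    and h: "h holomorphic_on ball 0 1" and g: "g holomorphic_on ball 0 1"
    and f: "\<And>z. cmod z < 1 \<Longrightarrow> f z = h z + cnj (g z)"
    and qc: "quasiconformal K f" and z: "cmod z < 1"
  shows "cmod (deriv g z) \<le> k * cmod (deriv h z)"
proof -
  define S where "S = {z \<in> ball 0 1. k * cmod (deriv h z) - cmod (deriv g z) < 0}"
  have "continuous_on (ball 0 1) (\<lambda>z. k * cmod (deriv h z) - cmod (deriv g z))"
    by (intro continuous_intros holomorphic_on_imp_continuous_on holomorphic_deriv h g) auto
  then have "open S"
    using continuous_open_preimage[of "ball 0 1" "\<lambda>z. k * cmod (deriv h z) - cmod (deriv g z)" "{..<0}"]
    by (simp add: S_def vimage_def Int_def)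
  obtain N where N: "N \<in> null_sets lebesgue"
    "\<And>z. z \<in> ball 0 1 \<Longrightarrow> z \<notin> N \<Longrightarrow> cmod (wirtinger_zbar f z) < cmod (wirtinger_z f z) \<and>
        (cmod (wirtinger_z f z) + cmod (wirtinger_zbar f z)) /
        (cmod (wirtinger_z f z) - cmod (wirtinger_zbar f z)) \<le> K"
  proof -
    have "AE z in lebesgue. z \<in> ball 0 1 \<longrightarrow> f differentiable (at z) \<and>
        cmod (wirtinger_zbar f z) < cmod (wirtinger_z f z) \<and>
        (cmod (wirtinger_z f z) + cmod (wirtinger_zbar f z)) /
        (cmod (wirtinger_z f z) - cmod (wirtinger_zbar f z)) \<le> K"
      using qc unfolding quasiconformal_def by blast
    then have "AE z in lebesgue. z \<in> ball 0 1 \<longrightarrow> cmod (wirtinger_zbar f z) < cmod (wirtinger_z f z) \<and>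
        (cmod (wirtinger_z f z) + cmod (wirtinger_zbar f z)) /
        (cmod (wirtinger_z f z) - cmod (wirtinger_zbar f z)) \<le> K"
      by (rule eventually_mono) blast
    then show ?thesis using that by (elim AE_E3) (auto simp: space_completion)
  qed
  have "S \<subseteq> N"
  proof
    fix w assume w: "w \<in> S"
    show "w \<in> N"
    proof (rule ccontr)
      assume "w \<notin> N"
      have w1: "cmod w < 1" using w by (simp add: S_def)
      have fd: "frechet_derivative f (at w) = (\<lambda>v. deriv h w * v + cnj (deriv g w * v))"
        using frechet_derivative_at[OF harmonic_has_derivative[OF h g f w1]] by simp
      have "wirtinger_z f w = deriv h w" "wirtinger_zbar f w = cnj (deriv g w)"
        unfolding wirtinger_z_def wirtinger_zbar_def fd by (simp_all add: algebra_simps)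
      with N(2)[of w] \<open>w \<notin> N\<close> w1 have "cmod (deriv g w) < cmod (deriv h w)"
        "(cmod (deriv h w) + cmod (deriv g w)) / (cmod (deriv h w) - cmod (deriv g w)) \<le> K" by auto
      then have "(K + 1) * cmod (deriv g w) \<le> (K - 1) * cmod (deriv h w)"
        by (simp add: pos_divide_le_eq algebra_simps)
      then have "cmod (deriv g w) \<le> k * cmod (deriv h w)"
        using K by (simp add: k field_simps)
      then show False using w by (simp add: S_def)
    qed
  qed
  then have "negligible S" using N(1) negligible_iff_null_sets negligible_subset by blast
  then have "S = {}" using \<open>open S\<close> open_not_negligible by blast
  then have "z \<notin> S" by simp
  then show ?thesis using z by (simp add: S_def)
qed

text \<open>The left side of the equation is strictly increasing on \<open>[0, 1]\<close>, equals -1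
  at 0 and is positive at 1. The same monotonicity turns \<open>r \<le> r\<^sub>u k\<close> into the
  inequality through which the root is used.\<close>

lemma bohr_root_ex1:
  assumes k: "0 \<le> k"
  shows "\<exists>!r. bohr_root k r"
    and "0 \<le> r \<Longrightarrow> r \<le> r\<^sub>u k \<Longrightarrow> 8 * r + 4 * k * r * sqrt (1 + r) \<le> (1 - r)\<^sup>2 \<and> r < 1"
proof -
  define F where "F = (\<lambda>r. 8 * r + 4 * k * r * sqrt (1 + r) - (1 - r)\<^sup>2)"
  have mono: "F x < F y" if "0 \<le> x" "x < y" "y \<le> 1" for x y
  proof -
    have "4 * k * x * sqrt (1 + x) \<le> 4 * k * y * sqrt (1 + y)"
      using that k by (intro mult_mono) auto
    moreover have "(1 - y)\<^sup>2 \<le> (1 - x)\<^sup>2" using that by (intro power_mono) auto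
    ultimately show ?thesis unfolding F_def using that(2) by linarith
  qed
  have "\<exists>r\<ge>0. r \<le> 1 \<and> F r = 0"
    by (rule IVT') (use k in \<open>auto simp: F_def intro!: continuous_intros\<close>)
  then obtain r0 where r0: "0 \<le> r0" "r0 \<le> 1" "F r0 = 0" by blast
  have "0 \<le> 4 * k * sqrt 2" using k by simp
  then have "F 0 < 0" "0 < F 1" by (auto simp: F_def)
  then have "r0 \<noteq> 0" "r0 \<noteq> 1" using r0(3) by auto
  then have root: "bohr_root k r0" using r0 by (auto simp: bohr_root_def F_def)
  have uniq: "r = r0" if "bohr_root k r" for r
  proof -
    have "F r = 0" "0 \<le> r" "r \<le> 1" using that by (auto simp: bohr_root_def F_def)
    then show ?thesis using mono[of r r0] mono[of r0 r] r0 by (cases r r0 rule: linorder_cases) auto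
  qed
  show ex1: "\<exists>!r. bohr_root k r" using root uniq by blast
  have ru: "r\<^sub>u k = r0" unfolding r\<^sub>u_def using root uniq by (rule the_equality)
  assume r: "0 \<le> r" "r \<le> r\<^sub>u k"
  have "F r \<le> F r0" using mono[of r r0] r r0 ru by (cases "r = r0") auto
  moreover have "r < 1" using r ru \<open>r0 \<noteq> 1\<close> r0 by simp
  ultimately show "8 * r + 4 * k * r * sqrt (1 + r) \<le> (1 - r)\<^sup>2 \<and> r < 1"
    using r0 by (simp add: F_def)
qed

text \<open>As \<open>sqrt (1 + r)\<close> is at least 1, the root inequality yields
  \<open>(2 + k) r / (1 - r)^2 <= 1/4\<close>; and \<open>(1 + e/4) / 4 <= 1 / (4 - e)\<close> is
  just \<open>16 - e^2 <= 16\<close>, the origin of the allowance \<open>1 + e/4\<close>. Beyond 1/9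
  one would have \<open>8 r > 8/9 > 64/81 >= (1 - r)^2\<close>.\<close>

lemma bohr_constant_bound:
  fixes r k e :: real
  assumes r: "0 \<le> r" "r < 1" and k: "0 \<le> k" and e: "0 \<le> e" "e \<le> 2"
    and le: "8 * r + 4 * k * r * sqrt (1 + r) \<le> (1 - r)\<^sup>2"
  shows "(2 + k) * (r / (1 - r)\<^sup>2 * (1 + e / 4)) \<le> 1 / (4 - e)" "r \<le> 1 / 9"
proof -
  have "4 * k * r * 1 \<le> 4 * k * r * sqrt (1 + r)" using r k by (intro mult_left_mono) auto
  then have "(2 + k) * r * 4 \<le> (1 - r)\<^sup>2" using le by (simp add: algebra_simps)
  then have "(2 + k) * r / (1 - r)\<^sup>2 \<le> 1 / 4" using r by (simp add: pos_divide_le_eq)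
  then have "(2 + k) * r / (1 - r)\<^sup>2 * (1 + e / 4) \<le> 1 / 4 * (1 + e / 4)"
    using e by (intro mult_right_mono) auto
  also have "\<dots> \<le> 1 / (4 - e)"
    using e by (simp add: pos_le_divide_eq) (simp add: algebra_simps)
  finally show "(2 + k) * (r / (1 - r)\<^sup>2 * (1 + e / 4)) \<le> 1 / (4 - e)" by simp
  show "r \<le> 1 / 9"
  proof (rule ccontr)
    assume "\<not> r \<le> 1 / 9"
    then have "(1 - r)\<^sup>2 \<le> (8 / 9)\<^sup>2" using r by (intro power_mono) auto
    moreover have "8 * r \<le> (1 - r)\<^sup>2" using le r k by (smt (verit) mult_nonneg_nonneg real_sqrt_ge_zero)
    ultimately show False using \<open>\<not> r \<le> 1 / 9\<close> by (simp add: power2_eq_square)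
  qed
qed

theorem theorem4p6:
  fixes K k :: real
    and f h g \<psi> :: "complex \<Rightarrow> complex"
    and a b :: "nat \<Rightarrow> complex"
  assumes "K \<ge> 1"
    and "k = (K - 1) / (K + 1)"
    and "sense_preserving_harmonic_mapping f h g"
    and "quasiconformal K f"
    and "\<And>z. z \<in> \<bbbD> \<Longrightarrow> (\<lambda>n. a n * z ^ n) sums h z"
    and "\<And>z. z \<in> \<bbbD> \<Longrightarrow> (\<lambda>n. b (Suc n) * z ^ Suc n) sums g z"
    and "univalent \<psi>"
    and "h \<prec>\<^sub>s \<psi>"
  shows "(\<exists>!r. bohr_root k r) \<and>
    (\<forall>z r. cmod z = r \<and> r \<le> r\<^sub>u k \<longrightarrow>
       summable (\<lambda>n. (cmod (a (Suc n)) + cmod (b (Suc n))) * r ^ Suc n) \<and>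
       cmod (h z) + (\<Sum>n. (cmod (a (Suc n)) + cmod (b (Suc n))) * r ^ Suc n)
         \<le> cmod (\<psi> 0) + infdist (\<psi> 0) (frontier (\<psi> ` \<bbbD>)))"
proof -
  have k: "0 \<le> k" using assms(1,2) by simp
  have h: "h holomorphic_on ball 0 1" and g: "g holomorphic_on ball 0 1" and g0: "g 0 = 0"
    and f: "\<And>z. cmod z < 1 \<Longrightarrow> f z = h z + cnj (g z)"
    and sp: "\<And>z. cmod z < 1 \<Longrightarrow> (cmod (deriv h z))\<^sup>2 - (cmod (deriv g z))\<^sup>2 > 0"
    using assms(3) by (auto simp: sense_preserving_harmonic_mapping_def harmonic_mapping_def)
  have h': "deriv h z \<noteq> 0" if "cmod z < 1" for z
    using sp[OF that] zero_le_power2[of "cmod (deriv g z)"] by auto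
  have dil: "cmod (deriv g z) \<le> k * cmod (deriv h z)" if "cmod z < 1" for z
    by (rule quasiconformal_harmonic_dilatation[OF assms(1,2) h g f assms(4) that])
  have psi: "\<psi> holomorphic_on ball 0 1" "inj_on \<psi> (ball 0 1)"
    using assms(7) by (auto simp: univalent_def)
  obtain \<omega> where \<omega>: "\<omega> holomorphic_on ball 0 1" "\<omega> ` ball 0 1 \<subseteq> ball 0 1" "\<omega> 0 = 0"
    "\<And>z. cmod z < 1 \<Longrightarrow> h z = \<psi> (\<omega> z)"
    using assms(8) by (auto simp: subordinate_def)
  define H where "H = Abs_fps a"
  have H: "h has_fps_expansion H"
    unfolding H_def by (rule sums_imp_has_fps_expansion) (use assms(5) in auto)
  \<comment> \<open>The expansion of \<open>g\<close> starts at index 1, so the constant coefficient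
    is set to 0, whatever \<open>b 0\<close> is.\<close>
  define G where "G = Abs_fps (\<lambda>n. if n = 0 then 0 else b n)"
  have G: "g has_fps_expansion G"
    unfolding G_def
  proof (rule sums_imp_has_fps_expansion)
    fix z :: complex assume "cmod z < 1"
    then have "(\<lambda>n. (if Suc n = 0 then 0 else b (Suc n)) * z ^ Suc n) sums g z" using assms(6)[of z] by simp
    from sums_Suc[OF this] show "(\<lambda>n. (if n = 0 then 0 else b n) * z ^ n) sums g z" by simp
  qed
  define s where "s = (\<lambda>z. (\<psi> z - \<psi> 0) / deriv \<psi> 0)"
  have d0: "deriv \<psi> 0 \<noteq> 0" using univalent_deriv_nonzero[OF psi, of 0] by simp
  have s: "schlicht s" unfolding s_def by (rule univalent_normalised[OF psi])
  have hols: "s holomorphic_on ball 0 1" using s by (simp add: schlicht_def)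
  define S where "S = fps_expansion s 0"
  have S: "s has_fps_expansion S" unfolding S_def by (rule holomorphic_has_fps_expansion[OF hols])
  define P where "P = fps_const (\<psi> 0) + fps_const (deriv \<psi> 0) * S"
  have "(\<lambda>z. \<psi> 0 + deriv \<psi> 0 * s z) has_fps_expansion P"
    unfolding P_def by (rule has_fps_expansion_add[OF has_fps_expansion_const has_fps_expansion_cmult_left[OF S]])
  then have P: "\<psi> has_fps_expansion P" using d0 by (simp add: s_def)
  define c where "c = cmod (fps_nth S 2)"
  have c: "0 \<le> c" "c \<le> 2" using schlicht_second_coeff_le[OF s S] by (auto simp: c_def)
  have dist: "cmod (deriv \<psi> 0) / (2 + c) \<le> infdist (\<psi> 0) (frontier (\<psi> ` \<bbbD>))"
    using univalent_infdist_frontier_ge[OF psi S[unfolded s_def]] by (simp add: c_def)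
  have main: "summable (\<lambda>n. (cmod (a (Suc n)) + cmod (b (Suc n))) * r ^ Suc n) \<and>
       cmod (h z) + (\<Sum>n. (cmod (a (Suc n)) + cmod (b (Suc n))) * r ^ Suc n)
         \<le> cmod (\<psi> 0) + infdist (\<psi> 0) (frontier (\<psi> ` \<bbbD>))"
    if z: "cmod z = r" and ru: "r \<le> r\<^sub>u k" for z r
  proof -
    have r0: "0 \<le> r" using z by auto
    have r1: "8 * r + 4 * k * r * sqrt (1 + r) \<le> (1 - r)\<^sup>2" "r < 1"
      using bohr_root_ex1(2)[OF k r0 ru] by auto
    have "2 - c \<ge> 0" "2 - c \<le> 2" using c by auto
    \<comment> \<open>The parameter is \<open>e = 2 - c\<close>, for which
      \<open>4 - e = 2 + c\<close> is the denominator in \<open>dist\<close>.\<close>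
    note const = bohr_constant_bound[OF r0 r1(2) k this r1(1)]
    have r3: "r \<le> 1 / 3" using const(2) by simp
    define T where "T = cmod (deriv \<psi> 0) * (r / (1 - r)\<^sup>2 * (1 + (2 - c) / 4))"
    have X: "(\<Sum>n<N. cmod (a (Suc n)) * r ^ Suc n) \<le> T" for N
    proof -
      have "(\<Sum>n<N. cmod (a (Suc n)) * r ^ Suc n) \<le> (\<Sum>n<N. cmod (fps_nth P (Suc n)) * r ^ Suc n)"
        using subordinate_coeff_sum_le[OF psi(1) P \<omega>(1-3) H \<omega>(4) r0 r3, of N] by (simp add: H_def)
      also have "\<dots> = cmod (deriv \<psi> 0) * (\<Sum>n<N. cmod (fps_nth S (Suc n)) * r ^ Suc n)"
        by (simp add: P_def norm_mult sum_distrib_left mult_ac)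
      also have "\<dots> \<le> T"
        unfolding T_def c_def by (intro mult_left_mono schlicht_coeff_sum_le[OF s S r0 const(2)]) auto
      finally show ?thesis .
    qed
    have Y: "(\<Sum>n<N. cmod (b (Suc n)) * r ^ Suc n) \<le> k * T" for N
    proof -
      have "(\<Sum>n<N. cmod (b (Suc n)) * r ^ Suc n) \<le> k * (\<Sum>n<N. cmod (a (Suc n)) * r ^ Suc n)"
        using dilatation_coeff_sum_le[OF h H g G h' dil r0 r3, of N] by (simp add: H_def G_def)
      also have "\<dots> \<le> k * T" by (intro mult_left_mono X k)
      finally show ?thesis .
    qed
    have XY: "(\<Sum>n<N. (cmod (a (Suc n)) + cmod (b (Suc n))) * r ^ Suc n) \<le> (1 + k) * T" for N
      using X[of N] Y[of N] by (simp add: distrib_right sum.distrib)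
    have sm: "summable (\<lambda>n. (cmod (a (Suc n)) + cmod (b (Suc n))) * r ^ Suc n)"
      by (rule summableI_nonneg_bounded[OF _ XY]) (use r0 in auto)
    have 1: "(\<Sum>n. (cmod (a (Suc n)) + cmod (b (Suc n))) * r ^ Suc n) \<le> (1 + k) * T"
      by (rule suminf_le_const[OF sm XY])
    have "h 0 = \<psi> 0" using \<omega>(3,4) by simp
    then have a0: "a 0 = \<psi> 0" using fps_expansion_nth_low(1)[OF H] by (simp add: H_def)
    \<comment> \<open>Partial sums are considered from \<open>N = 1\<close> on, where they contain
      \<open>a 0 = \<psi> 0\<close>; the rest is bounded by \<open>X\<close>.\<close>
    have 2: "cmod (h z) \<le> cmod (\<psi> 0) + T"
    proof (rule Lim_bounded)
      have "(\<lambda>N. \<Sum>n<N. a n * z ^ n) \<longlonglongrightarrow> h z" using assms(5)[of z] z r1 by (simp add: sums_def)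
      then show "(\<lambda>N. cmod (\<Sum>n<N. a n * z ^ n)) \<longlonglongrightarrow> cmod (h z)" by (rule tendsto_norm)
      show "\<forall>N\<ge>1. cmod (\<Sum>n<N. a n * z ^ n) \<le> cmod (\<psi> 0) + T"
      proof safe
        fix N :: nat assume "1 \<le> N"
        then obtain M where M: "N = Suc M" by (cases N) auto
        have "cmod (\<Sum>n<N. a n * z ^ n) = cmod (\<psi> 0 + (\<Sum>n<M. a (Suc n) * z ^ Suc n))"
          unfolding M sum.lessThan_Suc_shift by (simp add: a0)
        also have "\<dots> \<le> cmod (\<psi> 0) + (\<Sum>n<M. cmod (a (Suc n) * z ^ Suc n))"
          by (rule order.trans[OF norm_triangle_ineq add_left_mono[OF norm_sum]])
        also have "(\<Sum>n<M. cmod (a (Suc n) * z ^ Suc n)) = (\<Sum>n<M. cmod (a (Suc n)) * r ^ Suc n)"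
          by (simp add: norm_mult norm_power z)
        also have "\<dots> \<le> T" by (rule X)
        finally show "cmod (\<Sum>n<N. a n * z ^ n) \<le> cmod (\<psi> 0) + T" by simp
      qed
    qed
    \<comment> \<open>The factor \<open>2 + k\<close> counts \<open>T\<close> once for
      \<open>cmod (h z)\<close>, once for the coefficients \<open>a\<close> and \<open>k\<close>
      times for the coefficients \<open>b\<close>.\<close>
    have "(2 + k) * T = cmod (deriv \<psi> 0) * ((2 + k) * (r / (1 - r)\<^sup>2 * (1 + (2 - c) / 4)))"
      by (simp add: T_def)
    also have "\<dots> \<le> cmod (deriv \<psi> 0) * (1 / (4 - (2 - c)))"
      by (intro mult_left_mono const(1)) auto
    also have "\<dots> = cmod (deriv \<psi> 0) / (2 + c)" by simp
    finally have "(2 + k) * T \<le> infdist (\<psi> 0) (frontier (\<psi> ` \<bbbD>))" using dist by simp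
    with 1 2 sm show ?thesis by (simp add: distrib_right)
  qed
  show ?thesis
  proof (intro conjI allI impI)
    show "\<exists>!r. bohr_root k r" by (rule bohr_root_ex1(1)[OF k])
  qed (use main in auto)
qed

end
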